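(* $\mathsf{ACA}_0$ proves the refined Rival--Sands theorem for graphs: for every infinite graph $G=(V,E)$ there is an infinite $H\subseteq V$ such that for every $x\in V$, either $H\cap N(x)$ is infinite or $|H\cap N(x)|\le1$; and moreover for every $x\in H$, either $H\cap N(x)$ is infinite or $H\cap N(x)=\emptyset$.
   Context: $\mathsf{ACA}_0$ is the subsystem of second-order arithmetic consisting of $\mathsf{RCA}_0$ ($\Sigma^0_1$ induction and $\Delta^0_1$ comprehension over basic arithmetic) plus arithmetical comprehension. A graph $G=(V,E)$ is simple with $V\subseteq\mathbb{N}$, $E\subseteq[V]^2$; infinite if $V$ is infinite; $N(x)=\{y\in V:(x,y)\in E\}$. *)

theory Defs
  imports Main
begin

section \<open>The language of second-order arithmetic\<close>

text \<open>
  Two-sorted de Bruijn syntax. Number variables and set variables are indexed independently: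
  \<open>AllN\<close> binds number index 0 and leaves set indices alone, \<open>AllS\<close> binds set index 0 and leaves
  number indices alone. Equality is primitive for numbers only; the only set terms are variables.
\<close>

datatype tm = Var nat | Zero | One | Add tm tm | Mul tm tm

datatype fm =
    Fls
  | Eq tm tm
  | Less tm tm
  | Mem tm nat
  | Imp fm fm
  | AllN fm
  | AllS fm

abbreviation Neg :: "fm \<Rightarrow> fm" where "Neg \<phi> \<equiv> Imp \<phi> Fls"
abbreviation Or :: "fm \<Rightarrow> fm \<Rightarrow> fm" where "Or \<phi> \<psi> \<equiv> Imp (Neg \<phi>) \<psi>"
abbreviation And :: "fm \<Rightarrow> fm \<Rightarrow> fm" where "And \<phi> \<psi> \<equiv> Neg (Imp \<phi> (Neg \<psi>))"
abbreviation Iff :: "fm \<Rightarrow> fm \<Rightarrow> fm" where "Iff \<phi> \<psi> \<equiv> And (Imp \<phi> \<psi>) (Imp \<psi> \<phi>)"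
abbreviation ExN :: "fm \<Rightarrow> fm" where "ExN \<phi> \<equiv> Neg (AllN (Neg \<phi>))"
abbreviation ExS :: "fm \<Rightarrow> fm" where "ExS \<phi> \<equiv> Neg (AllS (Neg \<phi>))"

primrec subst_tm :: "(nat \<Rightarrow> tm) \<Rightarrow> tm \<Rightarrow> tm" where
  "subst_tm \<sigma> (Var n) = \<sigma> n"
| "subst_tm \<sigma> Zero = Zero"
| "subst_tm \<sigma> One = One"
| "subst_tm \<sigma> (Add s t) = Add (subst_tm \<sigma> s) (subst_tm \<sigma> t)"
| "subst_tm \<sigma> (Mul s t) = Mul (subst_tm \<sigma> s) (subst_tm \<sigma> t)"

definition lift_tm :: "tm \<Rightarrow> tm" where
  "lift_tm = subst_tm (\<lambda>n. Var (Suc n))"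

text \<open>Simultaneous capture-avoiding substitution of terms (\<open>\<sigma>\<close>) for number variables and of
  set variables (\<open>\<tau>\<close>) for set variables.\<close>

primrec subst :: "(nat \<Rightarrow> tm) \<Rightarrow> (nat \<Rightarrow> nat) \<Rightarrow> fm \<Rightarrow> fm" where
  "subst \<sigma> \<tau> Fls = Fls"
| "subst \<sigma> \<tau> (Eq s t) = Eq (subst_tm \<sigma> s) (subst_tm \<sigma> t)"
| "subst \<sigma> \<tau> (Less s t) = Less (subst_tm \<sigma> s) (subst_tm \<sigma> t)"
| "subst \<sigma> \<tau> (Mem t X) = Mem (subst_tm \<sigma> t) (\<tau> X)"
| "subst \<sigma> \<tau> (Imp \<phi> \<psi>) = Imp (subst \<sigma> \<tau> \<phi>) (subst \<sigma> \<tau> \<psi>)"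
| "subst \<sigma> \<tau> (AllN \<phi>) = AllN (subst (case_nat (Var 0) (\<lambda>n. lift_tm (\<sigma> n))) \<tau> \<phi>)"
| "subst \<sigma> \<tau> (AllS \<phi>) = AllS (subst \<sigma> (case_nat 0 (\<lambda>X. Suc (\<tau> X))) \<phi>)"

definition liftN :: "fm \<Rightarrow> fm" where "liftN = subst (\<lambda>n. Var (Suc n)) id"
definition liftS :: "fm \<Rightarrow> fm" where "liftS = subst Var Suc"
definition instN :: "tm \<Rightarrow> fm \<Rightarrow> fm" where "instN t = subst (case_nat t Var) id"
definition instS :: "nat \<Rightarrow> fm \<Rightarrow> fm" where "instS X = subst Var (case_nat X id)"

primrec tm_below :: "nat \<Rightarrow> tm \<Rightarrow> bool" where
  "tm_below m (Var n) \<longleftrightarrow> n < m"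
| "tm_below m Zero \<longleftrightarrow> True"
| "tm_below m One \<longleftrightarrow> True"
| "tm_below m (Add s t) \<longleftrightarrow> tm_below m s \<and> tm_below m t"
| "tm_below m (Mul s t) \<longleftrightarrow> tm_below m s \<and> tm_below m t"

text \<open>All free number variables have index below \<open>m\<close> and all free set variables index below \<open>k\<close>.\<close>

primrec fm_below :: "nat \<Rightarrow> nat \<Rightarrow> fm \<Rightarrow> bool" where
  "fm_below m k Fls \<longleftrightarrow> True"
| "fm_below m k (Eq s t) \<longleftrightarrow> tm_below m s \<and> tm_below m t"
| "fm_below m k (Less s t) \<longleftrightarrow> tm_below m s \<and> tm_below m t"
| "fm_below m k (Mem t X) \<longleftrightarrow> tm_below m t \<and> X < k"
| "fm_below m k (Imp \<phi> \<psi>) \<longleftrightarrow> fm_below m k \<phi> \<and> fm_below m k \<psi>"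
| "fm_below m k (AllN \<phi>) \<longleftrightarrow> fm_below (Suc m) k \<phi>"
| "fm_below m k (AllS \<phi>) \<longleftrightarrow> fm_below m (Suc k) \<phi>"

definition sentence :: "fm \<Rightarrow> bool" where
  "sentence \<phi> \<longleftrightarrow> fm_below 0 0 \<phi>"

section \<open>Provability\<close>

text \<open>
  Classical two-sorted natural deduction with equality. Lifting the assumptions in the
  quantifier introduction rules is the eigenvariable condition.
\<close>

inductive proves :: "fm set \<Rightarrow> fm \<Rightarrow> bool" (infix \<open>\<turnstile>\<close> 50) where
  Assm: "\<phi> \<in> \<Gamma> \<Longrightarrow> \<Gamma> \<turnstile> \<phi>"
| ImpI: "insert \<phi> \<Gamma> \<turnstile> \<psi> \<Longrightarrow> \<Gamma> \<turnstile> Imp \<phi> \<psi>"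
| ImpE: "\<Gamma> \<turnstile> Imp \<phi> \<psi> \<Longrightarrow> \<Gamma> \<turnstile> \<phi> \<Longrightarrow> \<Gamma> \<turnstile> \<psi>"
| Raa: "insert (Neg \<phi>) \<Gamma> \<turnstile> Fls \<Longrightarrow> \<Gamma> \<turnstile> \<phi>"
| AllN_I: "liftN ` \<Gamma> \<turnstile> \<phi> \<Longrightarrow> \<Gamma> \<turnstile> AllN \<phi>"
| AllN_E: "\<Gamma> \<turnstile> AllN \<phi> \<Longrightarrow> \<Gamma> \<turnstile> instN t \<phi>"
| AllS_I: "liftS ` \<Gamma> \<turnstile> \<phi> \<Longrightarrow> \<Gamma> \<turnstile> AllS \<phi>"
| AllS_E: "\<Gamma> \<turnstile> AllS \<phi> \<Longrightarrow> \<Gamma> \<turnstile> instS X \<phi>"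
| EqRefl: "\<Gamma> \<turnstile> Eq t t"
| EqSubst: "\<Gamma> \<turnstile> Eq s t \<Longrightarrow> \<Gamma> \<turnstile> instN s \<phi> \<Longrightarrow> \<Gamma> \<turnstile> instN t \<phi>"

section \<open>The systems RCA\<open>\<^sub>0\<close> and ACA\<open>\<^sub>0\<close>\<close>

text \<open>The lifted bound \<open>t\<close> cannot contain the quantified variable.\<close>

inductive bounded :: "fm \<Rightarrow> bool" where
  "bounded Fls"
| "bounded (Eq s t)"
| "bounded (Less s t)"
| "bounded (Mem t X)"
| "bounded \<phi> \<Longrightarrow> bounded \<psi> \<Longrightarrow> bounded (Imp \<phi> \<psi>)"
| "bounded \<phi> \<Longrightarrow> bounded (AllN (Imp (Less (Var 0) (lift_tm t)) \<phi>))"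
| "bounded \<phi> \<Longrightarrow> bounded (ExN (And (Less (Var 0) (lift_tm t)) \<phi>))"

definition Sigma01 :: "fm set" where "Sigma01 = {ExN \<theta> | \<theta>. bounded \<theta>}"
definition Pi01 :: "fm set" where "Pi01 = {AllN \<theta> | \<theta>. bounded \<theta>}"

text \<open>No set quantifiers; free set variables (parameters) are allowed.\<close>

primrec arithmetical :: "fm \<Rightarrow> bool" where
  "arithmetical Fls \<longleftrightarrow> True"
| "arithmetical (Eq s t) \<longleftrightarrow> True"
| "arithmetical (Less s t) \<longleftrightarrow> True"
| "arithmetical (Mem t X) \<longleftrightarrow> True"
| "arithmetical (Imp \<phi> \<psi>) \<longleftrightarrow> arithmetical \<phi> \<and> arithmetical \<psi>"
| "arithmetical (AllN \<phi>) \<longleftrightarrow> arithmetical \<phi>"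
| "arithmetical (AllS \<phi>) \<longleftrightarrow> False"

definition basic_axioms :: "fm set" where
  "basic_axioms =
    {Neg (Eq (Add (Var 0) One) Zero),
     Imp (Eq (Add (Var 0) One) (Add (Var 1) One)) (Eq (Var 0) (Var 1)),
     Eq (Add (Var 0) Zero) (Var 0),
     Eq (Add (Var 0) (Add (Var 1) One)) (Add (Add (Var 0) (Var 1)) One),
     Eq (Mul (Var 0) Zero) Zero,
     Eq (Mul (Var 0) (Add (Var 1) One)) (Add (Mul (Var 0) (Var 1)) (Var 0)),
     Neg (Less (Var 0) Zero),
     Iff (Less (Var 0) (Add (Var 1) One)) (Or (Less (Var 0) (Var 1)) (Eq (Var 0) (Var 1)))}"

text \<open>
  In the schemes below, number index 0 of \<open>\<phi>\<close> and \<open>\<psi>\<close> is the distinguished variable \<open>n\<close>; all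
  other free variables are parameters. In \<open>comprehension\<close> the comprehended set is set index 0,
  and \<open>liftS\<close> ensures that it is not free in \<open>\<phi>\<close>.
\<close>

definition induction_ax :: "fm \<Rightarrow> fm" where
  "induction_ax \<phi> =
    Imp (And (instN Zero \<phi>)
             (AllN (Imp \<phi> (subst (case_nat (Add (Var 0) One) (\<lambda>n. Var (Suc n))) id \<phi>))))
        (AllN \<phi>)"

definition comprehension :: "fm \<Rightarrow> fm" where
  "comprehension \<phi> = ExS (AllN (Iff (Mem (Var 0) 0) (liftS \<phi>)))"

definition univ_closures :: "fm set \<Rightarrow> fm set" where
  "univ_closures A =
    {(AllS ^^ k) ((AllN ^^ m) \<phi>) | k m \<phi>. \<phi> \<in> A \<and> sentence ((AllS ^^ k) ((AllN ^^ m) \<phi>))}"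

definition RCA0 :: "fm set" where
  "RCA0 = univ_closures
    (basic_axioms
     \<union> {induction_ax \<phi> | \<phi>. \<phi> \<in> Sigma01}
     \<union> {Imp (AllN (Iff \<phi> \<psi>)) (comprehension \<phi>) | \<phi> \<psi>. \<phi> \<in> Sigma01 \<and> \<psi> \<in> Pi01})"

definition ACA0 :: "fm set" where
  "ACA0 = RCA0 \<union> univ_closures {comprehension \<phi> | \<phi>. arithmetical \<phi>}"

section \<open>The refined Rival--Sands theorem for graphs\<close>

text \<open>The standard pairing \<open>(s, t) = (s + t)\<^sup>2 + s\<close> of second-order arithmetic.\<close>

definition pair :: "tm \<Rightarrow> tm \<Rightarrow> tm" where
  "pair s t = Add (Mul (Add s t) (Add s t)) s"

text \<open>
  \<open>E \<subseteq> [V]\<^sup>2\<close>, where an unordered pair is coded by the pair of its elements in increasing order.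
  The bound variables are \<open>e = Var 2\<close>, \<open>x = Var 1\<close>, \<open>y = Var 0\<close>.
\<close>

definition is_graph :: "nat \<Rightarrow> nat \<Rightarrow> fm" where
  "is_graph V E =
    AllN (Imp (Mem (Var 0) E)
      (ExN (ExN (And (And (Mem (Var 1) V) (Mem (Var 0) V))
                     (And (Less (Var 1) (Var 0)) (Eq (Var 2) (pair (Var 1) (Var 0))))))))"

definition edge :: "nat \<Rightarrow> tm \<Rightarrow> tm \<Rightarrow> fm" where
  "edge E x y = Or (And (Less x y) (Mem (pair x y) E)) (And (Less y x) (Mem (pair y x) E))"

text \<open>\<open>y \<in> N(x)\<close>\<close>

definition nbr :: "nat \<Rightarrow> nat \<Rightarrow> tm \<Rightarrow> tm \<Rightarrow> fm" where
  "nbr V E x y = And (Mem y V) (edge E x y)"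

text \<open>\<open>y \<in> H \<inter> N(x)\<close>\<close>

definition mem_inter_nbr :: "nat \<Rightarrow> nat \<Rightarrow> nat \<Rightarrow> tm \<Rightarrow> tm \<Rightarrow> fm" where
  "mem_inter_nbr V E H x y = And (Mem y H) (nbr V E x y)"

text \<open>Infinite means unbounded, as usual over RCA\<open>\<^sub>0\<close>.\<close>

definition infinite_set :: "nat \<Rightarrow> fm" where
  "infinite_set X = AllN (ExN (And (Less (Var 1) (Var 0)) (Mem (Var 0) X)))"

definition infinite_inter_nbr :: "nat \<Rightarrow> nat \<Rightarrow> nat \<Rightarrow> tm \<Rightarrow> fm" where
  "infinite_inter_nbr V E H x =
    AllN (ExN (And (Less (Var 1) (Var 0))
                   (mem_inter_nbr V E H (lift_tm (lift_tm x)) (Var 0))))"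

definition at_most_one_inter_nbr :: "nat \<Rightarrow> nat \<Rightarrow> nat \<Rightarrow> tm \<Rightarrow> fm" where
  "at_most_one_inter_nbr V E H x =
    AllN (AllN (Imp (And (mem_inter_nbr V E H (lift_tm (lift_tm x)) (Var 1))
                         (mem_inter_nbr V E H (lift_tm (lift_tm x)) (Var 0)))
                    (Eq (Var 1) (Var 0))))"

definition empty_inter_nbr :: "nat \<Rightarrow> nat \<Rightarrow> nat \<Rightarrow> tm \<Rightarrow> fm" where
  "empty_inter_nbr V E H x = AllN (Neg (mem_inter_nbr V E H (lift_tm x) (Var 0)))"

definition rival_sands_solution :: "nat \<Rightarrow> nat \<Rightarrow> nat \<Rightarrow> fm" where
  "rival_sands_solution V E H =
    And (And (infinite_set H) (AllN (Imp (Mem (Var 0) H) (Mem (Var 0) V))))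
   (And (AllN (Imp (Mem (Var 0) V)
          (Or (infinite_inter_nbr V E H (Var 0)) (at_most_one_inter_nbr V E H (Var 0)))))
        (AllN (Imp (Mem (Var 0) H)
          (Or (infinite_inter_nbr V E H (Var 0)) (empty_inter_nbr V E H (Var 0))))))"

text \<open>\<open>V\<close> is set index 1 and \<open>E\<close> is set index 0; below the quantifier for \<open>H\<close> they become 2 and 1.\<close>

definition refined_rival_sands :: fm where
  "refined_rival_sands =
    AllS (AllS (Imp (And (is_graph 1 0) (infinite_set 1)) (ExS (rival_sands_solution 2 1 0))))"

end

theory Submission
  imports Defs "HOL-Library.Countable_Set"
begin

text \<open>
  By a Henkin completeness argument it suffices to verify the sentence in every countable model of
  ACA\<open>\<^sub>0\<close>, whose sets are closed under arithmetical comprehension. Let \<open>F\<close> be the set of vertices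
  with finitely many neighbours. If \<open>F\<close> is finite, take for \<open>H\<close> all vertices beyond \<open>F\<close> and the
  neighbours of \<open>F\<close>. If \<open>F\<close> is infinite, build \<open>H \<subseteq> F\<close> greedily: a new element avoids the
  neighbours of the earlier ones, and it avoids \<open>N(v)\<close> whenever \<open>v\<close> is a neighbour of an earlier one
  and \<open>N(v) \<inter> F\<close> is finite; at the same time each \<open>v\<close> with \<open>N(v) \<inter> F\<close> infinite is given infinitely
  many neighbours in \<open>H\<close>. Recursion along the numbers of the model is justified by coding finite
  sets by divisibility, as with Goedel's beta function.
\<close>

section \<open>Substitution\<close>

text \<open>A model may be nonstandard, so induction and recursion on \<open>nat\<close> do not
  reach all of its numbers. Every property used in an induction must be shown arithmetical, and
  every maximum over finitely many objects becomes a collection argument. This is the purpose of the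
  calculus of \<open>AD\<close> predicates, and the reason why the histories in the recursion are
  coded by numbers: the set so defined stays arithmetical.

  When \<open>F\<close> is infinite the demands on \<open>H\<close> pull in opposite directions:
  some vertices must be hit infinitely often, the others at most once. They are compatible because a
  chosen \<open>h\<close> in \<open>F\<close> has only finitely many neighbours \<open>v\<close>,
  and each \<open>v\<close> with \<open>N(v) \<inter> F\<close> finite blocks only finitely many
  candidates; so \<open>h\<close> excludes only finitely many later elements. This is why
  \<open>H\<close> is sought inside \<open>F\<close>. Avoiding the neighbours of earlier elements
  makes \<open>H\<close> independent, which settles the extra clause about elements of
  \<open>H\<close>.\<close>

abbreviation up :: "(nat \<Rightarrow> tm) \<Rightarrow> nat \<Rightarrow> tm" where
  "up \<sigma> \<equiv> case_nat (Var 0) (\<lambda>n. lift_tm (\<sigma> n))"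

abbreviation upS :: "(nat \<Rightarrow> nat) \<Rightarrow> nat \<Rightarrow> nat" where
  "upS \<tau> \<equiv> case_nat 0 (\<lambda>X. Suc (\<tau> X))"

lemma subst_tm_subst_tm: "subst_tm \<sigma> (subst_tm \<rho> t) = subst_tm (\<lambda>n. subst_tm \<sigma> (\<rho> n)) t"
  by (induction t) auto

lemma subst_tm_Var [simp]: "subst_tm Var t = t"
  by (induction t) auto

lemma subst_tm_up_lift_tm: "subst_tm (up \<sigma>) (lift_tm t) = lift_tm (subst_tm \<sigma> t)"
  by (simp add: lift_tm_def subst_tm_subst_tm)

text \<open>Lifting and instantiation are substitutions too, so by this composition law their
  commutation rules reduce to comparing two maps pointwise.\<close>

lemma subst_subst:
  "subst \<sigma> \<tau> (subst \<rho> \<kappa> \<phi>) = subst (\<lambda>n. subst_tm \<sigma> (\<rho> n)) (\<lambda>X. \<tau> (\<kappa> X)) \<phi>"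
proof (induction \<phi> arbitrary: \<sigma> \<tau> \<rho> \<kappa>)
  case (AllN \<phi>)
  have "(\<lambda>n. subst_tm (up \<sigma>) (up \<rho> n)) = up (\<lambda>n. subst_tm \<sigma> (\<rho> n))"
    by (auto simp: fun_eq_iff subst_tm_up_lift_tm split: nat.split)
  then show ?case by (simp add: AllN)
next
  case (AllS \<phi>)
  have "(\<lambda>X. upS \<tau> (upS \<kappa> X)) = upS (\<lambda>X. \<tau> (\<kappa> X))"
    by (auto simp: fun_eq_iff split: nat.split)
  then show ?case by (simp add: AllS)
qed (auto simp: subst_tm_subst_tm)

lemma subst_tm_cong: "tm_below m t \<Longrightarrow> (\<And>n. n < m \<Longrightarrow> \<sigma> n = \<rho> n) \<Longrightarrow> subst_tm \<sigma> t = subst_tm \<rho> t"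
  by (induction t) auto

lemma subst_cong:
  "fm_below m k \<phi> \<Longrightarrow> (\<And>n. n < m \<Longrightarrow> \<sigma> n = \<rho> n) \<Longrightarrow> (\<And>X. X < k \<Longrightarrow> \<tau> X = \<kappa> X)
    \<Longrightarrow> subst \<sigma> \<tau> \<phi> = subst \<rho> \<kappa> \<phi>"
proof (induction \<phi> arbitrary: m k \<sigma> \<rho> \<tau> \<kappa>)
  case (AllN \<phi>)
  have "subst (up \<sigma>) \<tau> \<phi> = subst (up \<rho>) \<kappa> \<phi>"
    by (rule AllN.IH[of "Suc m" k]) (use AllN.prems in \<open>auto split: nat.split\<close>)
  then show ?case by simp
next
  case (AllS \<phi>)
  have "subst \<sigma> (upS \<tau>) \<phi> = subst \<rho> (upS \<kappa>) \<phi>"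
    by (rule AllS.IH[of m "Suc k"]) (use AllS.prems in \<open>auto split: nat.split\<close>)
  then show ?case by simp
next
  case (Imp \<phi> \<psi>)
  have "subst \<sigma> \<tau> \<phi> = subst \<rho> \<kappa> \<phi>" "subst \<sigma> \<tau> \<psi> = subst \<rho> \<kappa> \<psi>"
    by (rule Imp.IH[of m k]; use Imp.prems in auto)+
  then show ?case by simp
qed (auto intro: subst_tm_cong)

lemma subst_Var_id [simp]: "subst Var id \<phi> = \<phi>"
proof (induction \<phi>)
  case (AllN \<phi>)
  have "up Var = Var" by (auto simp: fun_eq_iff lift_tm_def split: nat.split)
  then show ?case by (simp only: subst.simps AllN)
next
  case (AllS \<phi>)
  have "upS id = id" by (auto simp: fun_eq_iff split: nat.split)
  then show ?case by (simp only: subst.simps AllS)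
qed auto

lemma subst_sentence: "sentence \<phi> \<Longrightarrow> subst \<sigma> \<tau> \<phi> = \<phi>"
  using subst_cong[of 0 0 \<phi> \<sigma> Var \<tau> id] by (simp add: sentence_def)

lemma tm_below_mono: "tm_below m t \<Longrightarrow> m \<le> m' \<Longrightarrow> tm_below m' t"
  by (induction t) auto

lemma fm_below_mono: "fm_below m k \<phi> \<Longrightarrow> m \<le> m' \<Longrightarrow> k \<le> k' \<Longrightarrow> fm_below m' k' \<phi>"
  by (induction \<phi> arbitrary: m k m' k') (auto dest: tm_below_mono)

lemma ex_tm_below: "\<exists>m. tm_below m t"
proof (induction t)
  case (Add s t)
  then obtain a b where "tm_below a s" "tm_below b t" by blast
  then have "tm_below (max a b) (Add s t)" by (auto intro: tm_below_mono)
  then show ?case by blast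
next
  case (Mul s t)
  then obtain a b where "tm_below a s" "tm_below b t" by blast
  then have "tm_below (max a b) (Mul s t)" by (auto intro: tm_below_mono)
  then show ?case by blast
qed auto

lemma ex_fm_below: "\<exists>m k. fm_below m k \<phi>"
proof (induction \<phi>)
  case (Eq s t)
  from ex_tm_below[of "Add s t"] show ?case by auto
next
  case (Less s t)
  from ex_tm_below[of "Add s t"] show ?case by auto
next
  case (Mem t X)
  from ex_tm_below[of t] show ?case by auto
next
  case (Imp \<phi> \<psi>)
  then obtain a b c d where "fm_below a b \<phi>" "fm_below c d \<psi>" by blast
  then have "fm_below (max a c) (max b d) (Imp \<phi> \<psi>)" by (auto intro: fm_below_mono)
  then show ?case by blast
next
  case (AllN \<phi>)
  then obtain a b where "fm_below a b \<phi>" by blast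
  then have "fm_below a b (AllN \<phi>)" by (auto intro: fm_below_mono)
  then show ?case by blast
next
  case (AllS \<phi>)
  then obtain a b where "fm_below a b \<phi>" by blast
  then have "fm_below a b (AllS \<phi>)" by (auto intro: fm_below_mono)
  then show ?case by blast
qed auto

lemma finite_ex_fm_below:
  assumes "finite \<Delta>" shows "\<exists>m k. \<forall>\<phi>\<in>\<Delta>. fm_below m k \<phi>"
  using assms
proof induction
  case (insert \<phi> \<Delta>)
  then obtain a b c d where "fm_below a b \<phi>" "\<forall>\<psi>\<in>\<Delta>. fm_below c d \<psi>"
    using ex_fm_below[of \<phi>] by blast
  then have "\<forall>\<psi>\<in>insert \<phi> \<Delta>. fm_below (max a c) (max b d) \<psi>"
    by (auto intro: fm_below_mono)
  then show ?case by blast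
qed auto

lemma fm_below_AllN: "fm_below (n + m) k \<phi> \<Longrightarrow> fm_below n k ((AllN ^^ m) \<phi>)"
  by (induction m arbitrary: n) auto

lemma fm_below_AllS: "fm_below n (j + k) \<phi> \<Longrightarrow> fm_below n j ((AllS ^^ k) \<phi>)"
  by (induction k arbitrary: j) auto

section \<open>Structural properties of provability\<close>

lemma weaken: "\<Gamma> \<turnstile> \<phi> \<Longrightarrow> \<Gamma> \<subseteq> \<Delta> \<Longrightarrow> \<Delta> \<turnstile> \<phi>"
proof (induction arbitrary: \<Delta> rule: proves.induct)
  case (ImpI \<phi> \<Gamma> \<psi>)
  then show ?case by (meson insert_mono proves.ImpI)
next
  case (Raa \<phi> \<Gamma>)
  then show ?case by (meson insert_mono proves.Raa)
next
  case (AllN_I \<Gamma> \<phi>)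
  then show ?case by (meson image_mono proves.AllN_I)
next
  case (AllS_I \<Gamma> \<phi>)
  then show ?case by (meson image_mono proves.AllS_I)
next
  case (EqSubst \<Gamma> s t \<phi>)
  then show ?case by (meson proves.EqSubst)
qed (auto intro: proves.Assm proves.ImpE proves.AllN_E proves.AllS_E proves.EqRefl)

lemma subst_liftN: "subst (up \<sigma>) \<tau> (liftN \<phi>) = liftN (subst \<sigma> \<tau> \<phi>)"
  by (simp add: liftN_def subst_subst lift_tm_def id_def)

lemma subst_liftS: "subst \<sigma> (upS \<tau>) (liftS \<phi>) = liftS (subst \<sigma> \<tau> \<phi>)"
  by (simp add: liftS_def subst_subst)

lemma instN_subst_up: "instN t (subst (up \<sigma>) \<tau> \<phi>) = subst (case_nat t \<sigma>) \<tau> \<phi>"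
proof -
  have "(\<lambda>n. subst_tm (case_nat t Var) (up \<sigma> n)) = case_nat t \<sigma>"
    by (auto simp: fun_eq_iff lift_tm_def subst_tm_subst_tm split: nat.split)
  then show ?thesis by (simp add: instN_def subst_subst)
qed

lemma instS_subst_upS: "instS X (subst \<sigma> (upS \<tau>) \<phi>) = subst \<sigma> (case_nat X \<tau>) \<phi>"
proof -
  have "(\<lambda>Y. case_nat X id (upS \<tau> Y)) = case_nat X \<tau>"
    by (auto simp: fun_eq_iff split: nat.split)
  then show ?thesis by (simp add: instS_def subst_subst)
qed

lemma subst_instN: "subst \<sigma> \<tau> (instN t \<phi>) = instN (subst_tm \<sigma> t) (subst (up \<sigma>) \<tau> \<phi>)"
proof -
  have "(\<lambda>n. subst_tm \<sigma> (case_nat t Var n)) = case_nat (subst_tm \<sigma> t) \<sigma>"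
    by (auto simp: fun_eq_iff split: nat.split)
  then show ?thesis by (simp add: instN_subst_up) (simp add: instN_def subst_subst)
qed

lemma subst_instS: "subst \<sigma> \<tau> (instS X \<phi>) = instS (\<tau> X) (subst \<sigma> (upS \<tau>) \<phi>)"
proof -
  have "(\<lambda>Y. \<tau> (case_nat X id Y)) = case_nat (\<tau> X) \<tau>"
    by (auto simp: fun_eq_iff split: nat.split)
  then show ?thesis by (simp add: instS_subst_upS) (simp add: instS_def subst_subst)
qed

text \<open>Needed for renaming: it carries a derivation about a named fresh variable to the lifted
  form that the quantifier introduction rules demand.\<close>

lemma proves_subst: "\<Gamma> \<turnstile> \<phi> \<Longrightarrow> subst \<sigma> \<tau> ` \<Gamma> \<turnstile> subst \<sigma> \<tau> \<phi>"
proof (induction arbitrary: \<sigma> \<tau> rule: proves.induct)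
  case (AllN_I \<Gamma> \<phi>)
  have "subst (up \<sigma>) \<tau> ` liftN ` \<Gamma> = liftN ` subst \<sigma> \<tau> ` \<Gamma>"
    by (simp add: image_image subst_liftN)
  then show ?case using AllN_I.IH[of "up \<sigma>" \<tau>] by (simp add: proves.AllN_I)
next
  case (AllS_I \<Gamma> \<phi>)
  have "subst \<sigma> (upS \<tau>) ` liftS ` \<Gamma> = liftS ` subst \<sigma> \<tau> ` \<Gamma>"
    by (simp add: image_image subst_liftS)
  then show ?case using AllS_I.IH[of \<sigma> "upS \<tau>"] by (simp add: proves.AllS_I)
next
  case (ImpI \<phi> \<Gamma> \<psi>)
  then show ?case by (simp add: proves.ImpI)
next
  case (ImpE \<Gamma> \<phi> \<psi>)
  then show ?case by (metis proves.ImpE subst.simps(5))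
next
  case (Raa \<phi> \<Gamma>)
  from Raa.IH[of \<sigma> \<tau>] show ?case by (simp add: proves.Raa)
next
  case (AllN_E \<Gamma> \<phi> t)
  from AllN_E.IH[of \<sigma> \<tau>] show ?case by (simp add: subst_instN proves.AllN_E)
next
  case (AllS_E \<Gamma> \<phi> X)
  from AllS_E.IH[of \<sigma> \<tau>] show ?case by (simp add: subst_instS proves.AllS_E)
next
  case (EqSubst \<Gamma> s t \<phi>)
  from EqSubst.IH[of \<sigma> \<tau>] show ?case
    using proves.EqSubst by (simp add: subst_instN)
qed (auto intro: proves.intros)

lemma proves_finite: "\<Gamma> \<turnstile> \<phi> \<Longrightarrow> \<exists>\<Delta>. finite \<Delta> \<and> \<Delta> \<subseteq> \<Gamma> \<and> \<Delta> \<turnstile> \<phi>"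
proof (induction rule: proves.induct)
  case (Assm \<phi> \<Gamma>)
  then show ?case by (intro exI[of _ "{\<phi>}"]) (auto intro: proves.Assm)
next
  case (ImpI \<phi> \<Gamma> \<psi>)
  then obtain \<Delta> where "finite \<Delta>" "\<Delta> \<subseteq> insert \<phi> \<Gamma>" "\<Delta> \<turnstile> \<psi>" by blast
  then show ?case
    by (intro exI[of _ "\<Delta> - {\<phi>}"] conjI, simp, blast) (rule proves.ImpI, erule weaken, blast)
next
  case (Raa \<phi> \<Gamma>)
  then obtain \<Delta> where "finite \<Delta>" "\<Delta> \<subseteq> insert (Neg \<phi>) \<Gamma>" "\<Delta> \<turnstile> Fls" by blast
  then show ?case
    by (intro exI[of _ "\<Delta> - {Neg \<phi>}"] conjI, simp, blast) (rule proves.Raa, erule weaken, blast)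
next
  case (ImpE \<Gamma> \<phi> \<psi>)
  then obtain \<Delta> \<Delta>' where "finite \<Delta>" "\<Delta> \<subseteq> \<Gamma>" "\<Delta> \<turnstile> Imp \<phi> \<psi>" "finite \<Delta>'" "\<Delta>' \<subseteq> \<Gamma>" "\<Delta>' \<turnstile> \<phi>"
    by blast
  then show ?case
    by (meson finite_Un le_sup_iff proves.ImpE sup_ge1 sup_ge2 weaken)
next
  case (EqSubst \<Gamma> s t \<phi>)
  then obtain \<Delta> \<Delta>' where "finite \<Delta>" "\<Delta> \<subseteq> \<Gamma>" "\<Delta> \<turnstile> Eq s t" "finite \<Delta>'" "\<Delta>' \<subseteq> \<Gamma>" "\<Delta>' \<turnstile> instN s \<phi>"
    by blast
  then show ?case
    by (meson finite_Un le_sup_iff proves.EqSubst sup_ge1 sup_ge2 weaken)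
next
  case (AllN_I \<Gamma> \<phi>)
  then obtain \<Delta> where "finite \<Delta>" "\<Delta> \<subseteq> liftN ` \<Gamma>" "\<Delta> \<turnstile> \<phi>" by blast
  then show ?case using finite_subset_image[of \<Delta> liftN \<Gamma>] by (metis proves.AllN_I)
next
  case (AllS_I \<Gamma> \<phi>)
  then obtain \<Delta> where "finite \<Delta>" "\<Delta> \<subseteq> liftS ` \<Gamma>" "\<Delta> \<turnstile> \<phi>" by blast
  then show ?case using finite_subset_image[of \<Delta> liftS \<Gamma>] by (metis proves.AllS_I)
next
  case (AllN_E \<Gamma> \<phi> t)
  then show ?case by (meson proves.AllN_E)
next
  case (AllS_E \<Gamma> \<phi> X)
  then show ?case by (meson proves.AllS_E)
next
  case (EqRefl \<Gamma> t)
  then show ?case by (meson proves.EqRefl finite.emptyI empty_subsetI)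
qed

lemma AllN_I_fresh:
  assumes "\<Gamma> \<turnstile> instN (Var m) \<phi>"
    and below: "\<And>\<psi>. \<psi> \<in> \<Gamma> \<Longrightarrow> fm_below m k \<psi>" and "fm_below (Suc m) k \<phi>"
  shows "\<Gamma> \<turnstile> AllN \<phi>"
proof -
  \<comment> \<open>Below \<open>m\<close> this is the lifting, and the fresh \<open>Var m\<close>
    goes to the bound position; so the assumptions get lifted while the instance at
    \<open>Var m\<close> turns back into \<open>\<phi>\<close>.\<close>
  define \<sigma> where "\<sigma> n = (if n = m then Var 0 else Var (Suc n))" for n
  have "subst \<sigma> id \<psi> = liftN \<psi>" if "\<psi> \<in> \<Gamma>" for \<psi>
    unfolding liftN_def by (rule subst_cong[OF below[OF that]]) (auto simp: \<sigma>_def)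
  then have "subst \<sigma> id ` \<Gamma> = liftN ` \<Gamma>" by auto
  moreover have "subst \<sigma> id (instN (Var m) \<phi>) = subst Var id \<phi>"
    unfolding instN_def subst_subst
    by (rule subst_cong[OF assms(3)]) (auto simp: \<sigma>_def split: nat.split)
  ultimately show ?thesis
    using proves_subst[OF assms(1), of \<sigma> id] by (simp add: AllN_I)
qed

lemma AllS_I_fresh:
  assumes "\<Gamma> \<turnstile> instS k \<phi>"
    and below: "\<And>\<psi>. \<psi> \<in> \<Gamma> \<Longrightarrow> fm_below m k \<psi>" and "fm_below m (Suc k) \<phi>"
  shows "\<Gamma> \<turnstile> AllS \<phi>"
proof -
  define \<tau> where "\<tau> n = (if n = k then 0 else Suc n)" for n
  have "subst Var \<tau> \<psi> = liftS \<psi>" if "\<psi> \<in> \<Gamma>" for \<psi>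
    unfolding liftS_def by (rule subst_cong[OF below[OF that]]) (auto simp: \<tau>_def)
  then have "subst Var \<tau> ` \<Gamma> = liftS ` \<Gamma>" by auto
  moreover have "subst Var \<tau> (instS k \<phi>) = subst Var id \<phi>"
    unfolding instS_def subst_subst
    by (rule subst_cong[OF assms(3)]) (auto simp: \<tau>_def split: nat.split)
  ultimately show ?thesis
    using proves_subst[OF assms(1), of Var \<tau>] by (simp add: AllS_I)
qed

section \<open>Henkin extensions\<close>

instance tm :: countable by countable_datatype
instance fm :: countable by countable_datatype

text \<open>The last two conjuncts are Henkin witnesses: a refuted universal formula comes with a
  refuted instance. Existential formulas are negated universal ones, so no other witnesses are
  required.\<close>

definition decides :: "fm set \<Rightarrow> fm \<Rightarrow> bool" where
  "decides \<Delta> \<phi> \<longleftrightarrow> \<phi> \<in> \<Delta> \<or> (Neg \<phi> \<in> \<Delta>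
     \<and> (\<forall>\<psi>. \<phi> = AllN \<psi> \<longrightarrow> (\<exists>t. Neg (instN t \<psi>) \<in> \<Delta>))
     \<and> (\<forall>\<psi>. \<phi> = AllS \<psi> \<longrightarrow> (\<exists>X. Neg (instS X \<psi>) \<in> \<Delta>)))"

lemma decides_mono: "decides \<Delta> \<phi> \<Longrightarrow> \<Delta> \<subseteq> \<Delta>' \<Longrightarrow> decides \<Delta>' \<phi>"
  unfolding decides_def by blast

text \<open>Splitting the assumptions into sentences \<open>\<Gamma>\<close> and a finite
  \<open>\<Delta>\<close> guarantees fresh variables even if \<open>\<Gamma>\<close> is infinite;
  they act as Henkin constants.\<close>

lemma extend_to_decide:
  assumes sent: "\<And>\<psi>. \<psi> \<in> \<Gamma> \<Longrightarrow> sentence \<psi>" and "finite \<Delta>" and cons: "\<not> \<Gamma> \<union> \<Delta> \<turnstile> Fls"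
  shows "\<exists>\<Delta>'. finite \<Delta>' \<and> \<Delta> \<subseteq> \<Delta>' \<and> \<not> \<Gamma> \<union> \<Delta>' \<turnstile> Fls \<and> decides \<Delta>' \<phi>"
proof (cases "\<Gamma> \<union> insert \<phi> \<Delta> \<turnstile> Fls")
  case False
  then show ?thesis using \<open>finite \<Delta>\<close> by (intro exI[of _ "insert \<phi> \<Delta>"]) (auto simp: decides_def)
next
  case True
  let ?\<Delta> = "insert (Neg \<phi>) \<Delta>"
  have neg: "\<Gamma> \<union> \<Delta> \<turnstile> Neg \<phi>" using True by (auto intro: ImpI)
  have cons': "\<not> \<Gamma> \<union> ?\<Delta> \<turnstile> Fls"
    using neg cons ImpI[of "Neg \<phi>" "\<Gamma> \<union> \<Delta>" Fls] by (auto intro: ImpE)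
  have step: "\<not> insert (Neg \<psi>) (\<Gamma> \<union> ?\<Delta>) \<turnstile> Fls" if "\<not> \<Gamma> \<union> ?\<Delta> \<turnstile> \<psi>" for \<psi>
    using that by (blast intro: Raa)
  have phi: "\<not> \<Gamma> \<union> ?\<Delta> \<turnstile> \<phi>"
    using cons' by (meson Assm ImpE UnI2 insertI1)
  obtain m k where mk: "\<forall>\<psi>\<in>insert \<phi> ?\<Delta>. fm_below m k \<psi>"
    using finite_ex_fm_below[of "insert \<phi> ?\<Delta>"] \<open>finite \<Delta>\<close> by auto
  have below: "fm_below m k \<psi>" if "\<psi> \<in> \<Gamma> \<union> ?\<Delta>" for \<psi>
    using that mk sent[of \<psi>] fm_below_mono[of 0 0 \<psi> m k] by (auto simp: sentence_def)
  show ?thesis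
  proof (cases \<phi>)
    case (AllN \<psi>)
    have "\<not> \<Gamma> \<union> ?\<Delta> \<turnstile> instN (Var m) \<psi>"
      using AllN_I_fresh[OF _ below] phi mk AllN by auto
    from step[OF this] AllN \<open>finite \<Delta>\<close> show ?thesis
      by (intro exI[of _ "insert (Neg (instN (Var m) \<psi>)) ?\<Delta>"]) (auto simp: decides_def)
  next
    case (AllS \<psi>)
    have "\<not> \<Gamma> \<union> ?\<Delta> \<turnstile> instS k \<psi>"
      using AllS_I_fresh[OF _ below] phi mk AllS by auto
    from step[OF this] AllS \<open>finite \<Delta>\<close> show ?thesis
      by (intro exI[of _ "insert (Neg (instS k \<psi>)) ?\<Delta>"]) (auto simp: decides_def)
  qed (use cons' \<open>finite \<Delta>\<close> in \<open>intro exI[of _ ?\<Delta>]; auto simp: decides_def\<close>)+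
qed

text \<open>Stage \<open>n\<close> decides the formula with code \<open>n\<close>. The union is
  consistent because a derivation uses finitely many assumptions, all present at a single
  stage.\<close>

lemma Henkin_extension:
  assumes sent: "\<And>\<psi>. \<psi> \<in> \<Gamma> \<Longrightarrow> sentence \<psi>" and cons: "\<not> \<Gamma> \<turnstile> Fls"
  shows "\<exists>T. \<Gamma> \<subseteq> T \<and> \<not> T \<turnstile> Fls \<and> (\<forall>\<phi>. decides T \<phi>)"
proof -
  let ?P = "\<lambda>(n::nat) \<Delta>. finite \<Delta> \<and> \<not> \<Gamma> \<union> \<Delta> \<turnstile> Fls"
  let ?Q = "\<lambda>n \<Delta> \<Delta>'. \<Delta> \<subseteq> \<Delta>' \<and> decides \<Delta>' (from_nat n)"
  have "\<exists>f. \<forall>n. ?P n (f n) \<and> ?Q n (f n) (f (Suc n))"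
  proof (rule dependent_nat_choice)
    show "\<exists>\<Delta>. ?P 0 \<Delta>" using cons by (intro exI[of _ "{}"]) auto
  next
    fix \<Delta> n assume "?P n \<Delta>"
    then show "\<exists>\<Delta>'. ?P (Suc n) \<Delta>' \<and> ?Q n \<Delta> \<Delta>'"
      using extend_to_decide[where \<Gamma> = \<Gamma> and \<Delta> = \<Delta> and \<phi> = "from_nat n"] sent by blast
  qed
  then obtain f where f: "\<And>n. ?P n (f n)" "\<And>n. ?Q n (f n) (f (Suc n))" by blast
  have mono: "f i \<subseteq> f j" if "i \<le> j" for i j
    using lift_Suc_mono_le[of f, OF _ that] f(2) by blast
  define T where "T = (\<Union>n. \<Gamma> \<union> f n)"
  have "decides T \<phi>" for \<phi>
    using f(2)[of "to_nat \<phi>"] decides_mono[of "f (Suc (to_nat \<phi>))" \<phi> T]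
    by (auto simp: T_def)
  moreover have "\<not> T \<turnstile> Fls"
  proof
    assume "T \<turnstile> Fls"
    then obtain \<Delta> where \<Delta>: "finite \<Delta>" "\<Delta> \<subseteq> T" "\<Delta> \<turnstile> Fls" using proves_finite by blast
    have "\<exists>n. \<Delta> \<subseteq> \<Gamma> \<union> f n"
      using \<Delta>(1,2)
    proof induction
      case (insert \<phi> \<Delta>)
      then obtain n n' where "\<Delta> \<subseteq> \<Gamma> \<union> f n" "\<phi> \<in> \<Gamma> \<union> f n'" by (auto simp: T_def)
      then have "insert \<phi> \<Delta> \<subseteq> \<Gamma> \<union> f (max n n')"
        using mono[of n "max n n'"] mono[of n' "max n n'"] by auto
      then show ?case by blast
    qed auto
    with \<Delta>(3) f(1) show False using weaken by blast
  qed
  ultimately show ?thesis by (auto simp: T_def)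
qed

section \<open>Semantics\<close>

locale struct =
  fixes zero one :: 'a and add mul :: "'a \<Rightarrow> 'a \<Rightarrow> 'a" and less :: "'a \<Rightarrow> 'a \<Rightarrow> bool"
    and S :: "'a set set"
begin

primrec ev :: "(nat \<Rightarrow> 'a) \<Rightarrow> tm \<Rightarrow> 'a" where
  "ev e (Var n) = e n"
| "ev e Zero = zero"
| "ev e One = one"
| "ev e (Add s t) = add (ev e s) (ev e t)"
| "ev e (Mul s t) = mul (ev e s) (ev e t)"

primrec sat :: "(nat \<Rightarrow> 'a) \<Rightarrow> (nat \<Rightarrow> 'a set) \<Rightarrow> fm \<Rightarrow> bool" where
  "sat e s Fls \<longleftrightarrow> False"
| "sat e s (Eq t u) \<longleftrightarrow> ev e t = ev e u"
| "sat e s (Less t u) \<longleftrightarrow> less (ev e t) (ev e u)"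
| "sat e s (Mem t X) \<longleftrightarrow> ev e t \<in> s X"
| "sat e s (Imp \<phi> \<psi>) \<longleftrightarrow> (sat e s \<phi> \<longrightarrow> sat e s \<psi>)"
| "sat e s (AllN \<phi>) \<longleftrightarrow> (\<forall>x. sat (case_nat x e) s \<phi>)"
| "sat e s (AllS \<phi>) \<longleftrightarrow> (\<forall>X\<in>S. sat e (case_nat X s) \<phi>)"

lemma ev_subst_tm: "ev e (subst_tm \<sigma> t) = ev (\<lambda>n. ev e (\<sigma> n)) t"
  by (induction t) auto

lemma ev_lift_tm [simp]: "ev (case_nat x e) (lift_tm t) = ev e t"
  by (simp add: lift_tm_def ev_subst_tm)

lemma sat_subst: "sat e s (subst \<sigma> \<tau> \<phi>) = sat (\<lambda>n. ev e (\<sigma> n)) (\<lambda>X. s (\<tau> X)) \<phi>"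
proof (induction \<phi> arbitrary: e s \<sigma> \<tau>)
  case (AllN \<phi>)
  have "(\<lambda>n. ev (case_nat x e) (up \<sigma> n)) = case_nat x (\<lambda>n. ev e (\<sigma> n))" for x
    by (auto simp: fun_eq_iff split: nat.split)
  then show ?case by (simp add: AllN)
next
  case (AllS \<phi>)
  have "(\<lambda>Y. case_nat X s (upS \<tau> Y)) = case_nat X (\<lambda>Y. s (\<tau> Y))" for X
    by (auto simp: fun_eq_iff split: nat.split)
  then show ?case by (simp add: AllS)
qed (auto simp: ev_subst_tm)

end

text \<open>Axioms enter as open formulas true under every assignment, so the quantifier prefixes of
  their closures never have to be evaluated.\<close>

locale ACA0_model = struct +
  assumes S_nonempty: "S \<noteq> {}"
    and ACA0_axiom: "\<And>\<phi> e s. univ_closures {\<phi>} \<subseteq> ACA0 \<Longrightarrow> (\<And>X. s X \<in> S) \<Longrightarrow> sat e s \<phi>"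

text \<open>The term model of a Henkin theory is countably infinite since it satisfies the successor
  axioms, so its numbers can be taken from the type \<^typ>\<open>nat\<close>.\<close>

locale Henkin_theory =
  fixes T :: "fm set"
  assumes ACA0_subset: "ACA0 \<subseteq> T" and consistent: "\<not> T \<turnstile> Fls" and decided: "\<And>\<phi>. decides T \<phi>"
begin

lemma in_iff: "\<phi> \<in> T \<longleftrightarrow> T \<turnstile> \<phi>"
proof
  assume "T \<turnstile> \<phi>"
  then have "Neg \<phi> \<notin> T" using consistent by (meson Assm ImpE)
  then show "\<phi> \<in> T" using decided[of \<phi>] by (auto simp: decides_def)
qed (rule Assm)

lemma Fls_iff: "Fls \<notin> T"
  using consistent by (simp add: in_iff)

lemma Imp_iff: "Imp \<phi> \<psi> \<in> T \<longleftrightarrow> (\<phi> \<in> T \<longrightarrow> \<psi> \<in> T)"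
proof
  assume "Imp \<phi> \<psi> \<in> T" then show "\<phi> \<in> T \<longrightarrow> \<psi> \<in> T" unfolding in_iff by (blast intro: ImpE)
next
  assume *: "\<phi> \<in> T \<longrightarrow> \<psi> \<in> T"
  show "Imp \<phi> \<psi> \<in> T"
  proof (cases "\<psi> \<in> T")
    case True
    then show ?thesis unfolding in_iff by (meson ImpI weaken subset_insertI)
  next
    case False
    with * have "Neg \<phi> \<in> T" using decided[of \<phi>] by (auto simp: decides_def)
    then have "insert (Neg \<psi>) (insert \<phi> T) \<turnstile> Fls" by (meson Assm ImpE insertCI)
    then show ?thesis unfolding in_iff by (rule ImpI[OF Raa])
  qed
qed

lemma AllN_iff: "AllN \<phi> \<in> T \<longleftrightarrow> (\<forall>t. instN t \<phi> \<in> T)"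
proof
  assume "AllN \<phi> \<in> T" then show "\<forall>t. instN t \<phi> \<in> T" unfolding in_iff by (blast intro: AllN_E)
next
  assume "\<forall>t. instN t \<phi> \<in> T"
  then show "AllN \<phi> \<in> T" using decided[of "AllN \<phi>"] Fls_iff by (auto simp: decides_def Imp_iff)
qed

lemma AllS_iff: "AllS \<phi> \<in> T \<longleftrightarrow> (\<forall>X. instS X \<phi> \<in> T)"
proof
  assume "AllS \<phi> \<in> T" then show "\<forall>X. instS X \<phi> \<in> T" unfolding in_iff by (blast intro: AllS_E)
next
  assume "\<forall>X. instS X \<phi> \<in> T"
  then show "AllS \<phi> \<in> T" using decided[of "AllS \<phi>"] Fls_iff by (auto simp: decides_def Imp_iff)
qed

lemma Eq_subst: "Eq s t \<in> T \<Longrightarrow> instN s \<phi> \<in> T \<Longrightarrow> instN t \<phi> \<in> T"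
  unfolding in_iff by (rule EqSubst)

lemma Eq_refl: "Eq t t \<in> T"
  unfolding in_iff by (rule EqRefl)

text \<open>Leibniz substitution into a context with hole \<open>Var 0\<close>; the other terms are
  lifted so that filling the hole leaves them intact. Transitivity and the congruence laws use the
  same device.\<close>

lemma Eq_sym: "Eq s t \<in> T \<Longrightarrow> Eq t s \<in> T"
  using Eq_subst[of s t "Eq (Var 0) (lift_tm s)"] Eq_refl
  by (simp add: instN_def lift_tm_def subst_tm_subst_tm)

lemma Eq_trans: "Eq s t \<in> T \<Longrightarrow> Eq t u \<in> T \<Longrightarrow> Eq s u \<in> T"
  using Eq_subst[of t u "Eq (lift_tm s) (Var 0)"]
  by (simp add: instN_def lift_tm_def subst_tm_subst_tm)

lemma Eq_Add: assumes "Eq s s' \<in> T" "Eq t t' \<in> T" shows "Eq (Add s t) (Add s' t') \<in> T"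
proof -
  have "Eq (Add s t) (Add s' t) \<in> T"
    using Eq_subst[OF assms(1), of "Eq (lift_tm (Add s t)) (Add (Var 0) (lift_tm t))"] Eq_refl
    by (simp add: instN_def lift_tm_def subst_tm_subst_tm)
  then show ?thesis
    using Eq_subst[OF assms(2), of "Eq (lift_tm (Add s t)) (Add (lift_tm s') (Var 0))"]
    by (simp add: instN_def lift_tm_def subst_tm_subst_tm)
qed

lemma Eq_Mul: assumes "Eq s s' \<in> T" "Eq t t' \<in> T" shows "Eq (Mul s t) (Mul s' t') \<in> T"
proof -
  have "Eq (Mul s t) (Mul s' t) \<in> T"
    using Eq_subst[OF assms(1), of "Eq (lift_tm (Mul s t)) (Mul (Var 0) (lift_tm t))"] Eq_refl
    by (simp add: instN_def lift_tm_def subst_tm_subst_tm)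
  then show ?thesis
    using Eq_subst[OF assms(2), of "Eq (lift_tm (Mul s t)) (Mul (lift_tm s') (Var 0))"]
    by (simp add: instN_def lift_tm_def subst_tm_subst_tm)
qed

lemma Less_cong: assumes "Eq s s' \<in> T" "Eq t t' \<in> T" "Less s t \<in> T" shows "Less s' t' \<in> T"
proof -
  have "Less s' t \<in> T"
    using Eq_subst[OF assms(1), of "Less (Var 0) (lift_tm t)"] assms(3)
    by (simp add: instN_def lift_tm_def subst_tm_subst_tm)
  then show ?thesis
    using Eq_subst[OF assms(2), of "Less (lift_tm s') (Var 0)"]
    by (simp add: instN_def lift_tm_def subst_tm_subst_tm)
qed

lemma Mem_cong: "Eq s t \<in> T \<Longrightarrow> Mem s X \<in> T \<Longrightarrow> Mem t X \<in> T"
  using Eq_subst[of s t "Mem (Var 0) X"] by (simp add: instN_def)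

lemma all_subst_AllN: "(\<forall>\<sigma> \<tau>. subst \<sigma> \<tau> ((AllN ^^ m) \<phi>) \<in> T) \<Longrightarrow> subst \<sigma> \<tau> \<phi> \<in> T"
proof (induction m arbitrary: \<sigma> \<tau>)
  case (Suc m)
  have "subst \<sigma> \<tau> ((AllN ^^ m) \<phi>) \<in> T" for \<sigma> \<tau>
  proof -
    \<comment> \<open>The hypothesis is used at the tail of \<open>\<sigma>\<close>, so that
      instantiating the outer quantifier with \<open>\<sigma> 0\<close> gives back
      \<open>\<sigma>\<close>.\<close>
    have "AllN (subst (up (\<lambda>n. \<sigma> (Suc n))) \<tau> ((AllN ^^ m) \<phi>)) \<in> T"
      using Suc.prems[rule_format, of "\<lambda>n. \<sigma> (Suc n)" \<tau>] by simp
    then have "subst (case_nat (\<sigma> 0) (\<lambda>n. \<sigma> (Suc n))) \<tau> ((AllN ^^ m) \<phi>) \<in> T"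
      unfolding AllN_iff instN_subst_up by blast
    moreover have "case_nat (\<sigma> 0) (\<lambda>n. \<sigma> (Suc n)) = \<sigma>" by (auto simp: fun_eq_iff split: nat.split)
    ultimately show ?thesis by simp
  qed
  then show ?case using Suc.IH by blast
qed simp

lemma all_subst_AllS: "(\<forall>\<sigma> \<tau>. subst \<sigma> \<tau> ((AllS ^^ m) \<phi>) \<in> T) \<Longrightarrow> subst \<sigma> \<tau> \<phi> \<in> T"
proof (induction m arbitrary: \<sigma> \<tau>)
  case (Suc m)
  have "subst \<sigma> \<tau> ((AllS ^^ m) \<phi>) \<in> T" for \<sigma> \<tau>
  proof -
    have "AllS (subst \<sigma> (upS (\<lambda>n. \<tau> (Suc n))) ((AllS ^^ m) \<phi>)) \<in> T"
      using Suc.prems[rule_format, of \<sigma> "\<lambda>n. \<tau> (Suc n)"] by simp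
    then have "subst \<sigma> (case_nat (\<tau> 0) (\<lambda>n. \<tau> (Suc n))) ((AllS ^^ m) \<phi>) \<in> T"
      unfolding AllS_iff instS_subst_upS by blast
    moreover have "case_nat (\<tau> 0) (\<lambda>n. \<tau> (Suc n)) = \<tau>" by (auto simp: fun_eq_iff split: nat.split)
    ultimately show ?thesis by simp
  qed
  then show ?case using Suc.IH by blast
qed simp

lemma axiom_subst: assumes "univ_closures {\<phi>} \<subseteq> ACA0" shows "subst \<sigma> \<tau> \<phi> \<in> T"
proof -
  obtain m k where "fm_below m k \<phi>" using ex_fm_below by blast
  then have sent: "sentence ((AllS ^^ k) ((AllN ^^ m) \<phi>))"
    unfolding sentence_def using fm_below_AllN[of 0 m k \<phi>] fm_below_AllS[of 0 0 k] by simp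
  then have "(AllS ^^ k) ((AllN ^^ m) \<phi>) \<in> T"
    using assms ACA0_subset by (auto simp: univ_closures_def)
  then have "subst \<sigma> \<tau> ((AllS ^^ k) ((AllN ^^ m) \<phi>)) \<in> T" for \<sigma> \<tau>
    by (simp add: subst_sentence[OF sent])
  then show ?thesis using all_subst_AllN all_subst_AllS by blast
qed

section \<open>The term model\<close>

definition cls :: "tm \<Rightarrow> tm set" where "cls t = {s. Eq t s \<in> T}"

lemma cls_eq_iff: "cls s = cls t \<longleftrightarrow> Eq s t \<in> T"
proof
  assume "cls s = cls t"
  moreover have "t \<in> cls t" by (simp add: cls_def Eq_refl)
  ultimately have "t \<in> cls s" by simp
  then show "Eq s t \<in> T" by (simp add: cls_def)
next
  assume "Eq s t \<in> T"
  then show "cls s = cls t" unfolding cls_def using Eq_trans Eq_sym by (metis (no_types))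
qed

lemma basic_axiom_subst: "\<phi> \<in> basic_axioms \<Longrightarrow> subst \<sigma> \<tau> \<phi> \<in> T"
  by (rule axiom_subst) (auto simp: ACA0_def RCA0_def univ_closures_def)

text \<open>By the two successor axioms distinct numerals are never provably equal. Infinity makes
  \<open>to_nat_on\<close> a bijection from the classes onto \<open>nat\<close>.\<close>

lemma infinite_cls: "infinite (range cls)"
proof -
  let ?S = "\<lambda>t. Add t One"
  let ?num = "\<lambda>n. (?S ^^ n) Zero"
  have ax0: "Eq (?S t) Zero \<notin> T" for t
    using basic_axiom_subst[of "Neg (Eq (Add (Var 0) One) Zero)" "\<lambda>_. t" id] Fls_iff
    by (simp add: basic_axioms_def Imp_iff)
  have ax1: "Eq s t \<in> T" if "Eq (?S s) (?S t) \<in> T" for s t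
    using basic_axiom_subst[of "Imp (Eq (Add (Var 0) One) (Add (Var 1) One)) (Eq (Var 0) (Var 1))"
        "case_nat s (\<lambda>_. t)" id] that
    by (simp add: basic_axioms_def Imp_iff)
  have "n = m" if "Eq (?num n) (?num m) \<in> T" for n m
    using that
  proof (induction n arbitrary: m)
    case 0
    then show ?case using ax0 Eq_sym by (cases m) auto
  next
    case (Suc n)
    then show ?case using ax0 ax1 by (cases m) auto
  qed
  then have "inj (\<lambda>n. cls (?num n))" by (auto simp: inj_def cls_eq_iff)
  then have "infinite (range (\<lambda>n. cls (?num n)))" by (rule range_inj_infinite)
  then show ?thesis by (rule infinite_super[rotated]) auto
qed

definition q :: "tm \<Rightarrow> nat" where "q t = to_nat_on (range cls) (cls t)"

lemma q_eq_iff: "q s = q t \<longleftrightarrow> Eq s t \<in> T"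
  unfolding q_def to_nat_on_inj[OF countable_image[OF countableI_type] rangeI rangeI] by (rule cls_eq_iff)

lemma surj_q: "surj q"
proof -
  have "to_nat_on (range cls) ` range cls = UNIV"
    using to_nat_on_infinite[OF _ infinite_cls] by (simp add: bij_betw_def)
  then show ?thesis by (auto simp: q_def image_image)
qed

definition rep :: "nat \<Rightarrow> tm" where "rep = inv q"

lemma q_rep [simp]: "q (rep x) = x"
  unfolding rep_def by (rule surj_f_inv_f[OF surj_q])

lemma Eq_rep_q: "Eq (rep (q t)) t \<in> T"
  by (simp flip: q_eq_iff)

text \<open>Variables are the only set terms, and a refuted universal set formula is refuted at a
  variable; so these extensions suffice as the domain of sets.\<close>

definition ext :: "nat \<Rightarrow> nat set" where "ext X = {x. Mem (rep x) X \<in> T}"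

sublocale struct "q Zero" "q One" "\<lambda>x y. q (Add (rep x) (rep y))" "\<lambda>x y. q (Mul (rep x) (rep y))"
  "\<lambda>x y. Less (rep x) (rep y) \<in> T" "range ext" .

lemma mem_ext: "x \<in> ext X \<longleftrightarrow> Mem (rep x) X \<in> T"
  by (simp add: ext_def)

lemma ev_q: "ev (\<lambda>n. q (\<sigma> n)) t = q (subst_tm \<sigma> t)"
  by (induction t) (auto simp: q_eq_iff intro: Eq_Add Eq_Mul Eq_rep_q)

text \<open>The truth lemma. Stated for all substitutions, it absorbs an instance into
  \<open>case_nat t \<sigma>\<close>; surjectivity of \<open>q\<close> lets terms stand for all
  numbers.\<close>

lemma sat_iff: "sat (\<lambda>n. q (\<sigma> n)) (\<lambda>X. ext (\<tau> X)) \<phi> \<longleftrightarrow> subst \<sigma> \<tau> \<phi> \<in> T"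
proof (induction \<phi> arbitrary: \<sigma> \<tau>)
  case Fls
  then show ?case by (simp add: Fls_iff)
next
  case (Eq s t)
  then show ?case by (simp add: ev_q q_eq_iff)
next
  case (Less s t)
  show ?case
    by (simp add: ev_q) (rule iffI; erule Less_cong[rotated 2]; intro Eq_rep_q Eq_rep_q[THEN Eq_sym])
next
  case (Mem t X)
  show ?case
    by (simp add: ev_q mem_ext) (rule iffI; erule Mem_cong[rotated]; intro Eq_rep_q Eq_rep_q[THEN Eq_sym])
next
  case (Imp \<phi> \<psi>)
  then show ?case by (simp add: Imp_iff)
next
  case (AllN \<phi>)
  have eq: "case_nat (q t) (\<lambda>n. q (\<sigma> n)) = (\<lambda>n. q (case_nat t \<sigma> n))" for t
    by (auto simp: fun_eq_iff split: nat.split)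
  have "(\<forall>x. sat (case_nat x (\<lambda>n. q (\<sigma> n))) (\<lambda>X. ext (\<tau> X)) \<phi>)
      \<longleftrightarrow> (\<forall>t. sat (case_nat (q t) (\<lambda>n. q (\<sigma> n))) (\<lambda>X. ext (\<tau> X)) \<phi>)"
    by (metis q_rep)
  then show ?case by (simp add: AllN_iff instN_subst_up eq AllN.IH)
next
  case (AllS \<phi>)
  have eq: "case_nat (ext X) (\<lambda>n. ext (\<tau> n)) = (\<lambda>n. ext (case_nat X \<tau> n))" for X
    by (auto simp: fun_eq_iff split: nat.split)
  show ?case by (simp add: AllS_iff instS_subst_upS eq AllS.IH)
qed

lemma sat_iff_rep:
  assumes "\<And>X. s X \<in> range ext" shows "\<exists>\<sigma> \<tau>. \<forall>\<phi>. sat e s \<phi> \<longleftrightarrow> subst \<sigma> \<tau> \<phi> \<in> T"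
proof -
  from assms have "\<forall>X. \<exists>Y. s X = ext Y" by blast
  then obtain \<tau> where "s = (\<lambda>X. ext (\<tau> X))" by (metis ext)
  then show ?thesis using sat_iff[of "\<lambda>n. rep (e n)" \<tau>] by auto
qed

sublocale ACA0_model "q Zero" "q One" "\<lambda>x y. q (Add (rep x) (rep y))"
  "\<lambda>x y. q (Mul (rep x) (rep y))" "\<lambda>x y. Less (rep x) (rep y) \<in> T" "range ext"
proof
  show "sat e s \<phi>" if "univ_closures {\<phi>} \<subseteq> ACA0" "\<And>X. s X \<in> range ext" for \<phi> e s
    using sat_iff_rep[of s e] that axiom_subst by blast
qed auto

end

text \<open>The carrier is fixed to \<open>nat\<close> because a hypothesis cannot quantify over
  types; the term model of a Henkin theory has this carrier.\<close>

theorem ACA0_complete: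
  assumes valid: "\<And>(zero::nat) one add mul less S e s. ACA0_model zero one add mul less S
      \<Longrightarrow> (\<And>X. s X \<in> S) \<Longrightarrow> struct.sat zero one add mul less S e s \<phi>"
    and "sentence \<phi>"
  shows "ACA0 \<turnstile> \<phi>"
proof (rule ccontr)
  assume "\<not> ACA0 \<turnstile> \<phi>"
  then have "\<not> insert (Neg \<phi>) ACA0 \<turnstile> Fls" using Raa by blast
  moreover have "sentence \<psi>" if "\<psi> \<in> insert (Neg \<phi>) ACA0" for \<psi>
    using that \<open>sentence \<phi>\<close> by (auto simp: ACA0_def RCA0_def univ_closures_def sentence_def)
  ultimately obtain T where T: "insert (Neg \<phi>) ACA0 \<subseteq> T" "\<not> T \<turnstile> Fls" "\<And>\<phi>. decides T \<phi>"
    using Henkin_extension by metis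
  then interpret Henkin_theory T by unfold_locales auto
  have "sat (\<lambda>n. q (Var n)) (\<lambda>X. ext (id X)) \<phi>"
    using ACA0_model_axioms by (rule valid) auto
  then have "\<phi> \<in> T" using sat_iff[of Var id \<phi>] by simp
  with T(1) show False using Fls_iff by (auto simp: Imp_iff)
qed

section \<open>Arithmetical definability in models of ACA\<open>\<^sub>0\<close>\<close>

definition mix :: "(nat \<Rightarrow> 'b) \<Rightarrow> (nat \<Rightarrow> 'b) \<Rightarrow> nat \<Rightarrow> 'b" where
  "mix f g n = (if even n then f (n div 2) else g (n div 2))"

lemma mix_even [simp]: "mix f g (2 * n) = f n" and mix_odd [simp]: "mix f g (Suc (2 * n)) = g n"
  by (simp_all add: mix_def)

lemma arithmetical_subst [simp]: "arithmetical (subst \<sigma> \<tau> \<phi>) = arithmetical \<phi>"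
  by (induction \<phi> arbitrary: \<sigma> \<tau>) auto

lemma univ_closures_singleton: "\<phi> \<in> A \<Longrightarrow> univ_closures {\<phi>} \<subseteq> univ_closures A"
  by (auto simp: univ_closures_def)

context ACA0_model
begin

lemma RCA0_axiom:
  assumes "\<phi> \<in> basic_axioms \<union> {induction_ax \<phi> | \<phi>. \<phi> \<in> Sigma01}" "\<And>X. s X \<in> S"
  shows "sat e s \<phi>"
proof (rule ACA0_axiom)
  show "univ_closures {\<phi>} \<subseteq> ACA0"
    unfolding ACA0_def RCA0_def
    by (rule le_supI1, rule univ_closures_singleton) (use assms in blast)
qed (rule assms)

notation zero (\<open>\<zero>\<close>) and one (\<open>\<one>\<close>) and add (infixl \<open>\<oplus>\<close> 65) and mul (infixl \<open>\<otimes>\<close> 70)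
  and less (infix \<open>\<prec>\<close> 50)

text \<open>Variables of even index refer to the environment, those of odd index to number parameters.\<close>

definition TD :: "((nat \<Rightarrow> 'a) \<Rightarrow> 'a) \<Rightarrow> bool" where
  "TD f \<longleftrightarrow> (\<exists>t p. \<forall>e. f e = ev (mix e p) t)"

text \<open>With this semantic notion predicates can be written directly in HOL: closure rules,
  instead of explicit de Bruijn formulas, certify that comprehension and induction apply to
  them.\<close>

definition AD :: "((nat \<Rightarrow> 'a) \<Rightarrow> bool) \<Rightarrow> bool" where
  "AD P \<longleftrightarrow> (\<exists>\<phi> s p. arithmetical \<phi> \<and> (\<forall>X. s X \<in> S) \<and> (\<forall>e. P e \<longleftrightarrow> sat (mix e p) s \<phi>))"

text \<open>Parameter variables are sent to the even half (\<open>ren1\<close>) or the odd half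
  (\<open>ren2\<close>) of a common parameter sequence, so that two formulas can share one
  assignment.\<close>

definition ren1 :: "nat \<Rightarrow> nat" where "ren1 n = (if even n then n else Suc (2 * (2 * (n div 2))))"
definition ren2 :: "nat \<Rightarrow> nat" where "ren2 n = (if even n then n else Suc (2 * (Suc (2 * (n div 2)))))"

lemma mix_ren1 [simp]: "mix e (mix p p') (ren1 n) = mix e p n"
  by (auto simp: ren1_def mix_def elim: oddE)

lemma mix_ren2 [simp]: "mix e (mix p p') (ren2 n) = mix e p' n"
  by (simp add: ren2_def mix_def)

lemma TD_two:
  assumes "TD f" "TD g"
  shows "\<exists>t u p. \<forall>e. f e = ev (mix e p) t \<and> g e = ev (mix e p) u"
proof -
  obtain t p u p' where "\<forall>e. f e = ev (mix e p) t" "\<forall>e. g e = ev (mix e p') u"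
    using assms unfolding TD_def by blast
  then have "\<forall>e. f e = ev (mix e (mix p p')) (subst_tm (\<lambda>n. Var (ren1 n)) t)
      \<and> g e = ev (mix e (mix p p')) (subst_tm (\<lambda>n. Var (ren2 n)) u)"
    by (simp add: ev_subst_tm)
  then show ?thesis by blast
qed

lemma AD_two:
  assumes "AD P" "AD Q"
  shows "\<exists>\<phi> \<psi> s p. arithmetical \<phi> \<and> arithmetical \<psi> \<and> (\<forall>X. s X \<in> S)
    \<and> (\<forall>e. (P e \<longleftrightarrow> sat (mix e p) s \<phi>) \<and> (Q e \<longleftrightarrow> sat (mix e p) s \<psi>))"
proof -
  obtain \<phi> s p \<psi> s' p' where *: "arithmetical \<phi>" "\<forall>X. s X \<in> S" "\<forall>e. P e \<longleftrightarrow> sat (mix e p) s \<phi>"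
    "arithmetical \<psi>" "\<forall>X. s' X \<in> S" "\<forall>e. Q e \<longleftrightarrow> sat (mix e p') s' \<psi>"
    using assms unfolding AD_def by blast
  let ?\<phi> = "subst (\<lambda>n. Var (ren1 n)) (\<lambda>X. 2 * X) \<phi>"
  let ?\<psi> = "subst (\<lambda>n. Var (ren2 n)) (\<lambda>X. Suc (2 * X)) \<psi>"
  have "\<forall>e. (P e \<longleftrightarrow> sat (mix e (mix p p')) (mix s s') ?\<phi>) \<and>
      (Q e \<longleftrightarrow> sat (mix e (mix p p')) (mix s s') ?\<psi>)"
    using * by (simp add: sat_subst)
  moreover have "arithmetical ?\<phi>" "arithmetical ?\<psi>" "\<forall>X. mix s s' X \<in> S"
    using * by (auto simp: mix_def)
  ultimately show ?thesis by blast
qed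

definition some_set :: "nat \<Rightarrow> 'a set" where "some_set _ = (SOME X. X \<in> S)"

lemma some_set: "some_set n \<in> S"
  using S_nonempty unfolding some_set_def by (meson all_not_in_conv someI_ex)

lemma TD_var: "TD (\<lambda>e. e n)"
  unfolding TD_def by (intro exI[of _ "Var (2 * n)"]) simp

lemma TD_const: "TD (\<lambda>e. c)"
  unfolding TD_def by (intro exI[of _ "Var 1"] exI[of _ "\<lambda>_. c"]) (simp add: mix_def)

lemma TD_add: assumes "TD f" "TD g" shows "TD (\<lambda>e. f e \<oplus> g e)"
proof -
  obtain t u p where "\<forall>e. f e = ev (mix e p) t \<and> g e = ev (mix e p) u" using TD_two assms by blast
  then show ?thesis unfolding TD_def by (intro exI[of _ "Add t u"] exI[of _ p]) simp
qed

lemma TD_mul: assumes "TD f" "TD g" shows "TD (\<lambda>e. f e \<otimes> g e)"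
proof -
  obtain t u p where "\<forall>e. f e = ev (mix e p) t \<and> g e = ev (mix e p) u" using TD_two assms by blast
  then show ?thesis unfolding TD_def by (intro exI[of _ "Mul t u"] exI[of _ p]) simp
qed

lemma AD_eq: assumes "TD f" "TD g" shows "AD (\<lambda>e. f e = g e)"
proof -
  obtain t u p where "\<forall>e. f e = ev (mix e p) t \<and> g e = ev (mix e p) u" using TD_two assms by blast
  then show ?thesis unfolding AD_def
    by (intro exI[of _ "Eq t u"] exI[of _ some_set] exI[of _ p]) (simp add: some_set)
qed

lemma AD_less: assumes "TD f" "TD g" shows "AD (\<lambda>e. f e \<prec> g e)"
proof -
  obtain t u p where "\<forall>e. f e = ev (mix e p) t \<and> g e = ev (mix e p) u" using TD_two assms by blast
  then show ?thesis unfolding AD_def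
    by (intro exI[of _ "Less t u"] exI[of _ some_set] exI[of _ p]) (simp add: some_set)
qed

lemma AD_mem: assumes "X \<in> S" "TD f" shows "AD (\<lambda>e. f e \<in> X)"
proof -
  obtain t p where "\<forall>e. f e = ev (mix e p) t" using assms TD_def by blast
  then show ?thesis unfolding AD_def
    by (intro exI[of _ "Mem t 0"] exI[of _ "\<lambda>_. X"] exI[of _ p]) (simp add: assms)
qed

lemma AD_const: "AD (\<lambda>e. b)"
  unfolding AD_def
  by (intro exI[of _ "if b then Neg Fls else Fls"] exI[of _ some_set]) (simp add: some_set)

lemma AD_imp: assumes "AD P" "AD Q" shows "AD (\<lambda>e. P e \<longrightarrow> Q e)"
proof -
  obtain \<phi> \<psi> s p where "arithmetical \<phi>" "arithmetical \<psi>" "\<forall>X. s X \<in> S"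
    "\<forall>e. (P e \<longleftrightarrow> sat (mix e p) s \<phi>) \<and> (Q e \<longleftrightarrow> sat (mix e p) s \<psi>)"
    using AD_two[OF assms] by blast
  then show ?thesis unfolding AD_def
    by (intro exI[of _ "Imp \<phi> \<psi>"] exI[of _ s] exI[of _ p]) simp
qed

lemma AD_not: "AD P \<Longrightarrow> AD (\<lambda>e. \<not> P e)"
  using AD_imp[of P "\<lambda>_. False"] AD_const by simp

lemma AD_and: "AD P \<Longrightarrow> AD Q \<Longrightarrow> AD (\<lambda>e. P e \<and> Q e)"
  using AD_not[OF AD_imp[of P "\<lambda>e. \<not> Q e"]] AD_not by simp

lemma AD_or: "AD P \<Longrightarrow> AD Q \<Longrightarrow> AD (\<lambda>e. P e \<or> Q e)"
  using AD_imp[of "\<lambda>e. \<not> P e" Q] AD_not by (simp add: disj_imp)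

lemma AD_iff: "AD P \<Longrightarrow> AD Q \<Longrightarrow> AD (\<lambda>e. P e \<longleftrightarrow> Q e)"
  using AD_and[OF AD_imp[of P Q] AD_imp[of Q P]] by (simp add: iff_conv_conj_imp)

lemma AD_binder:
  assumes "AD (\<lambda>e. P (e 0) (\<lambda>n. e (Suc n)))"
  shows "\<exists>\<phi> s p. arithmetical \<phi> \<and> (\<forall>X. s X \<in> S) \<and> (\<forall>x e. P x e \<longleftrightarrow> sat (case_nat x (mix e p)) s \<phi>)"
proof -
  obtain \<phi> s p where *: "arithmetical \<phi>" "\<forall>X. s X \<in> S"
    "\<And>e. P (e 0) (\<lambda>n. e (Suc n)) \<longleftrightarrow> sat (mix e p) s \<phi>"
    using assms unfolding AD_def by blast
  \<comment> \<open>A quantifier puts its value in front of the interleaved sequence, the hypothesis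
    puts it in front of the environment alone. So positive even indices move down by one and odd
    ones move up by one.\<close>
  define \<rho> where "\<rho> n = (if n = 0 then 0 else if even n then n - 1 else Suc n)" for n :: nat
  have "case_nat x (mix e p) (\<rho> n) = mix (case_nat x e) p n" for x e n
  proof (cases "even n")
    case True
    then obtain k where "n = 2 * k" by (rule evenE)
    then show ?thesis by (cases k) (auto simp: \<rho>_def mix_def)
  next
    case False
    then show ?thesis by (auto simp: \<rho>_def mix_def)
  qed
  then have "P x e \<longleftrightarrow> sat (case_nat x (mix e p)) s (subst (\<lambda>n. Var (\<rho> n)) id \<phi>)" for x e
    using *(3)[of "case_nat x e"] by (simp add: sat_subst)
  moreover have "arithmetical (subst (\<lambda>n. Var (\<rho> n)) id \<phi>)" using * by simp
  ultimately show ?thesis using *(2) by blast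
qed

lemma AD_all: assumes "AD (\<lambda>e. P (e 0) (\<lambda>n. e (Suc n)))" shows "AD (\<lambda>e. \<forall>x. P x e)"
proof -
  obtain \<phi> s p where "arithmetical \<phi>" "\<forall>X. s X \<in> S"
    "\<forall>x e. P x e \<longleftrightarrow> sat (case_nat x (mix e p)) s \<phi>"
    using AD_binder[OF assms] by blast
  then show ?thesis unfolding AD_def
    by (intro exI[of _ "AllN \<phi>"] exI[of _ s] exI[of _ p]) simp
qed

lemma AD_ex: "AD (\<lambda>e. P (e 0) (\<lambda>n. e (Suc n))) \<Longrightarrow> AD (\<lambda>e. \<exists>x. P x e)"
  using AD_not[OF AD_all[OF AD_not], of P] by simp

lemmas AD_rules = TD_var TD_add TD_mul AD_eq AD_less AD_mem AD_imp AD_not AD_and AD_or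
  AD_iff AD_all AD_ex TD_const AD_const

lemma TD_shift: assumes "TD f" shows "TD (\<lambda>e. f (\<lambda>n. e (Suc n)))"
proof -
  obtain t p where t: "\<And>e. f e = ev (mix e p) t" using assms unfolding TD_def by blast
  let ?\<rho> = "\<lambda>n. if even n then n + 2 else n"
  have "mix (\<lambda>n. e (Suc n)) p = (\<lambda>n. mix e p (?\<rho> n))" for e by (auto simp: mix_def)
  then have "f (\<lambda>n. e (Suc n)) = ev (mix e p) (subst_tm (\<lambda>n. Var (?\<rho> n)) t)" for e
    by (simp add: t ev_subst_tm)
  then show ?thesis unfolding TD_def by blast
qed

lemma AD_inst: assumes "AD P" "TD f" shows "AD (\<lambda>e. P (case_nat (f e) e))"
proof -
  have "case_nat (e 0) (\<lambda>n. e (Suc n)) = e" for e :: "nat \<Rightarrow> 'a"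
    by (auto simp: fun_eq_iff split: nat.split)
  then have "AD (\<lambda>e. P (case_nat (e 0) (\<lambda>n. e (Suc n))))" using assms by simp
  \<comment> \<open>A quantifier and an equation replace a substitution into the defining
    formula.\<close>
  then have "AD (\<lambda>e. \<exists>x. x = f e \<and> P (case_nat x e))"
    by (intro AD_ex AD_and AD_eq TD_var TD_shift assms)
  then show ?thesis by simp
qed

lemma AD_app1:
  assumes "AD (\<lambda>e. P (e 0))" "TD f" shows "AD (\<lambda>e. P (f e))"
  using AD_inst[OF assms] by simp

lemma AD_app2:
  assumes "AD (\<lambda>e. P (e 0) (e 1))" "TD f" "TD g" shows "AD (\<lambda>e. P (f e) (g e))"
  using AD_inst[OF AD_inst[OF assms(1) TD_shift[OF assms(2)]] assms(3)] by simp

lemma AD_app3: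
  assumes "AD (\<lambda>e. P (e 0) (e 1) (e 2))" "TD f" "TD g" "TD h" shows "AD (\<lambda>e. P (f e) (g e) (h e))"
  using AD_inst[OF AD_inst[OF AD_inst[OF assms(1) TD_shift[OF TD_shift[OF assms(2)]]]
      TD_shift[OF assms(3)]] assms(4)]
  by (simp add: numeral_2_eq_2)

section \<open>Comprehension and induction for definable predicates\<close>

lemma comprehension: assumes "AD (\<lambda>e. P (e 0))" shows "{x. P x} \<in> S"
proof -
  obtain \<phi> s p where *: "arithmetical \<phi>" "\<forall>X. s X \<in> S"
    "\<And>x e. P x \<longleftrightarrow> sat (case_nat x (mix e p)) s \<phi>"
    using AD_binder[of "\<lambda>x e. P x"] assms by blast
  have "sat (mix undefined p) s (comprehension \<phi>)"
    using * by (intro ACA0_axiom) (auto simp: ACA0_def intro!: le_supI2 univ_closures_singleton)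
  then obtain X where "X \<in> S" "\<forall>x. x \<in> X \<longleftrightarrow> P x"
    by (auto simp: comprehension_def liftS_def sat_subst simp flip: *(3))
  then have "{x. P x} = X" by auto
  with \<open>X \<in> S\<close> show ?thesis by simp
qed

text \<open>The induction axioms cover only \<open>Sigma01\<close>; comprehension first turns
  \<open>P\<close> into a set, whose membership predicate is simple enough.\<close>

lemma M_induct [case_names arith zero suc]:
  assumes "AD (\<lambda>e. P (e 0))" "P \<zero>" "\<And>x. P x \<Longrightarrow> P (x \<oplus> \<one>)" shows "P x"
proof -
  define X where "X = {x. P x}"
  have X: "X \<in> S" unfolding X_def by (rule comprehension) (rule assms)
  \<comment> \<open>A dummy existential quantifier brings membership in \<open>X\<close> into
    \<open>Sigma01\<close> form; hence the induction variable has index 1.\<close>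
  have "bounded (Mem (Var 1) 0)" by (rule bounded.intros)
  then have "sat (\<lambda>_. \<zero>) (\<lambda>_. X) (induction_ax (ExN (Mem (Var 1) 0)))"
    by (intro RCA0_axiom X) (auto simp: Sigma01_def)
  then have "(\<forall>x. x \<in> X)"
    using assms by (simp add: induction_ax_def instN_def sat_subst lift_tm_def X_def)
  then show ?thesis by (simp add: X_def)
qed

section \<open>Arithmetic in models of ACA\<open>\<^sub>0\<close>\<close>

lemma basic_axiom: "\<phi> \<in> basic_axioms \<Longrightarrow> sat e some_set \<phi>"
  by (rule RCA0_axiom) (auto simp: some_set)

lemma basic_facts:
  shows succ_neq_zero [simp]: "x \<oplus> \<one> \<noteq> \<zero>"
    and succ_inj: "x \<oplus> \<one> = y \<oplus> \<one> \<Longrightarrow> x = y"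
    and add_zero [simp]: "x \<oplus> \<zero> = x"
    and add_succ: "x \<oplus> (y \<oplus> \<one>) = (x \<oplus> y) \<oplus> \<one>"
    and mul_zero [simp]: "x \<otimes> \<zero> = \<zero>"
    and mul_succ: "x \<otimes> (y \<oplus> \<one>) = (x \<otimes> y) \<oplus> x"
    and not_less_zero [simp]: "\<not> x \<prec> \<zero>"
    and less_succ_iff: "x \<prec> y \<oplus> \<one> \<longleftrightarrow> x \<prec> y \<or> x = y"
proof -
  have "\<forall>\<phi>\<in>basic_axioms. sat (case_nat x (\<lambda>_. y)) some_set \<phi>" using basic_axiom by blast
  note ax = this[unfolded basic_axioms_def, simplified]
  show "x \<oplus> \<one> \<noteq> \<zero>" "x \<oplus> \<one> = y \<oplus> \<one> \<Longrightarrow> x = y" "x \<oplus> \<zero> = x" "x \<oplus> (y \<oplus> \<one>) = (x \<oplus> y) \<oplus> \<one>"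
    "x \<otimes> \<zero> = \<zero>" "x \<otimes> (y \<oplus> \<one>) = (x \<otimes> y) \<oplus> x" "\<not> x \<prec> \<zero>"
    "x \<prec> y \<oplus> \<one> \<longleftrightarrow> x \<prec> y \<or> x = y"
    using ax by blast+
qed

lemmas zero_neq_succ [simp] = succ_neq_zero[symmetric]

lemma zero_add [simp]: "\<zero> \<oplus> x = x"
  by (induction x rule: M_induct) (intro AD_rules, auto simp: add_succ)

lemma one_neq_zero [simp]: "\<one> \<noteq> \<zero>"
  using succ_neq_zero[of \<zero>] by simp

lemma add_assoc: "(x \<oplus> y) \<oplus> z = x \<oplus> (y \<oplus> z)"
  by (induction z rule: M_induct) (intro AD_rules, auto simp: add_succ)

lemma succ_add: "(x \<oplus> \<one>) \<oplus> y = (x \<oplus> y) \<oplus> \<one>"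
  by (induction y rule: M_induct) (intro AD_rules, auto simp: add_succ)

lemma add_commute: "x \<oplus> y = y \<oplus> x"
  by (induction y rule: M_induct) (intro AD_rules, auto simp: add_succ succ_add)

lemma add_left_commute: "x \<oplus> (y \<oplus> z) = y \<oplus> (x \<oplus> z)"
  by (metis add_assoc add_commute)

lemma zero_mul [simp]: "\<zero> \<otimes> x = \<zero>"
  by (induction x rule: M_induct) (intro AD_rules, auto simp: mul_succ)

lemma succ_mul: "(x \<oplus> \<one>) \<otimes> y = (x \<otimes> y) \<oplus> y"
  by (induction y rule: M_induct)
    (intro AD_rules, auto simp: mul_succ add_assoc add_commute add_left_commute)

lemma mul_commute: "x \<otimes> y = y \<otimes> x"
  by (induction y rule: M_induct) (intro AD_rules, auto simp: mul_succ succ_mul)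

lemma distrib_right: "(x \<oplus> y) \<otimes> z = (x \<otimes> z) \<oplus> (y \<otimes> z)"
  by (induction z rule: M_induct)
    (intro AD_rules, auto simp: mul_succ add_assoc add_commute add_left_commute)

lemma mul_assoc: "(x \<otimes> y) \<otimes> z = x \<otimes> (y \<otimes> z)"
proof (induction z rule: M_induct)
  case (suc z)
  then show ?case by (simp add: mul_succ mul_commute[of x "_ \<oplus> _"] distrib_right) (metis mul_commute)
qed (intro AD_rules, auto)

lemma one_mul [simp]: "\<one> \<otimes> x = x"
  by (metis mul_commute mul_succ mul_zero zero_add)

lemma mul_one [simp]: "x \<otimes> \<one> = x"
  by (metis mul_commute one_mul)

lemma mul_left_commute: "x \<otimes> (y \<otimes> z) = y \<otimes> (x \<otimes> z)"
  by (metis mul_assoc mul_commute)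

lemma distrib_left: "x \<otimes> (y \<oplus> z) = (x \<otimes> y) \<oplus> (x \<otimes> z)"
  by (metis distrib_right mul_commute)

lemmas semiring_simps = add_assoc add_commute add_left_commute mul_assoc mul_commute
  mul_left_commute distrib_left distrib_right

lemma add_right_cancel: "x \<oplus> z = y \<oplus> z \<longleftrightarrow> x = y"
proof -
  have "x \<oplus> z = y \<oplus> z \<longrightarrow> x = y"
  proof (induction z rule: M_induct)
    case arith
    show ?case by (intro AD_rules)
  next
    case (suc z)
    then show ?case unfolding add_succ using succ_inj by blast
  qed simp
  then show ?thesis by auto
qed

lemma add_left_cancel: "z \<oplus> x = z \<oplus> y \<longleftrightarrow> x = y"
  using add_right_cancel add_commute by metis

section \<open>The order, expressed by differences, and collection\<close>

lemma zero_or_succ: "x = \<zero> \<or> (\<exists>y. x = y \<oplus> \<one>)"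
  by (induction x rule: M_induct) (intro AD_rules, auto)

lemma less_iff: "x \<prec> y \<longleftrightarrow> (\<exists>d. y = x \<oplus> d \<oplus> \<one>)"
proof (induction y rule: M_induct)
  case (suc y)
  have "x \<prec> y \<oplus> \<one> \<longleftrightarrow> (\<exists>d. y = x \<oplus> d)"
  proof
    assume "x \<prec> y \<oplus> \<one>"
    then show "\<exists>d. y = x \<oplus> d"
      unfolding less_succ_iff suc add_assoc using add_zero by metis
  next
    assume "\<exists>d. y = x \<oplus> d"
    then obtain d where "y = x \<oplus> d" by blast
    then show "x \<prec> y \<oplus> \<one>"
      unfolding less_succ_iff suc using zero_or_succ[of d] by (auto simp: add_assoc)
  qed
  then show ?case by (simp add: add_right_cancel)
next
  case zero
  show ?case using succ_neq_zero by (simp add: eq_commute[of "\<zero>"])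
qed (intro AD_rules)

definition le :: "'a \<Rightarrow> 'a \<Rightarrow> bool" (infix \<open>\<preceq>\<close> 50) where "x \<preceq> y \<longleftrightarrow> x \<prec> y \<or> x = y"

lemma le_iff: "x \<preceq> y \<longleftrightarrow> (\<exists>d. y = x \<oplus> d)"
proof
  assume "x \<preceq> y"
  then show "\<exists>d. y = x \<oplus> d" unfolding le_def less_iff add_assoc using add_zero by metis
next
  assume "\<exists>d. y = x \<oplus> d"
  then obtain d where "y = x \<oplus> d" by blast
  then show "x \<preceq> y" unfolding le_def less_iff using zero_or_succ[of d] by (auto simp: add_assoc)
qed

lemma add_eq_self: "x \<oplus> d = x \<longleftrightarrow> d = \<zero>"
  using add_left_cancel[of x d \<zero>] by simp

lemma add_eq_zero: "x \<oplus> y = \<zero> \<longleftrightarrow> x = \<zero> \<and> y = \<zero>"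
  using zero_or_succ[of y] by (auto simp flip: add_assoc)

lemma le_total: "x \<preceq> y \<or> y \<preceq> x"
proof (induction x rule: M_induct)
  case (suc x)
  show ?case
  proof (cases "y \<preceq> x")
    case True
    then show ?thesis by (auto simp: le_def less_succ_iff)
  next
    case False
    with suc have "x \<preceq> y" "x \<noteq> y" by (auto simp: le_def)
    then obtain d where "y = x \<oplus> d \<oplus> \<one>" by (auto simp: le_def less_iff)
    then show ?thesis unfolding le_iff by (metis add_assoc add_commute)
  qed
next
  case zero
  show ?case unfolding le_iff by (metis zero_add)
qed (unfold le_def, intro AD_rules)

sublocale O: linorder le less
proof
  show trans: "x \<preceq> z" if "x \<preceq> y" "y \<preceq> z" for x y z
    using that unfolding le_iff by (metis add_assoc)
  show anti: "x = y" if "x \<preceq> y" "y \<preceq> x" for x y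
    using that unfolding le_iff by (metis add_assoc add_eq_self add_eq_zero add_zero)
  show "x \<prec> y \<longleftrightarrow> x \<preceq> y \<and> \<not> y \<preceq> x" for x y
  proof -
    have "\<not> x \<prec> x" unfolding less_iff by (metis add_assoc add_eq_self succ_neq_zero)
    then show ?thesis using anti[of x y] by (auto simp: le_def)
  qed
qed (simp add: le_def, rule le_total)

lemma le_add [simp]: "x \<preceq> x \<oplus> y" "x \<preceq> y \<oplus> x"
  unfolding le_iff by (metis add_commute)+

lemma less_succ [simp]: "x \<prec> x \<oplus> \<one>"
  by (simp add: less_succ_iff)

lemma AD_le: "TD f \<Longrightarrow> TD g \<Longrightarrow> AD (\<lambda>e. f e \<preceq> g e)"
  unfolding le_def by (intro AD_rules)

lemma M_less_induct [case_names arith less]: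
  assumes P: "AD (\<lambda>e. P (e 0))" and step: "\<And>x. (\<And>y. y \<prec> x \<Longrightarrow> P y) \<Longrightarrow> P x" shows "P x"
proof -
  have "\<forall>y. y \<prec> x \<longrightarrow> P y" for x
  proof (induction x rule: M_induct)
    case arith
    show ?case by (intro AD_rules AD_app1[OF P])
  qed (use step in \<open>auto simp: less_succ_iff\<close>)
  then show ?thesis using less_succ by blast
qed

text \<open>The collection principle, in place of a maximum over finitely many \<open>y\<close>. By
  monotonicity the sum of two bounds serves as a common one.\<close>

lemma bounding:
  assumes Q: "AD (\<lambda>e. Q (e 0) (e 1))" and mono: "\<And>y p p'. Q y p \<Longrightarrow> p \<preceq> p' \<Longrightarrow> Q y p'"
    and ex: "\<And>y. y \<prec> m \<Longrightarrow> \<exists>p. Q y p"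
  shows "\<exists>p. \<forall>y. y \<prec> m \<longrightarrow> Q y p"
proof -
  have "n \<preceq> m \<longrightarrow> (\<exists>p. \<forall>y. y \<prec> n \<longrightarrow> Q y p)" for n
  proof (induction n rule: M_induct)
    case arith
    show ?case by (intro AD_rules AD_le AD_app2[OF Q])
  next
    case (suc n)
    show ?case
    proof
      assume "n \<oplus> \<one> \<preceq> m"
      then have "n \<prec> m" using less_succ O.less_le_trans by blast
      then obtain p p' where "\<forall>y. y \<prec> n \<longrightarrow> Q y p" "Q n p'" using suc ex O.less_imp_le by blast
      then have "\<forall>y. y \<prec> n \<oplus> \<one> \<longrightarrow> Q y (p \<oplus> p')"
        using mono le_add by (metis less_succ_iff)
      then show "\<exists>p. \<forall>y. y \<prec> n \<oplus> \<one> \<longrightarrow> Q y p" by blast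
    qed
  qed auto
  then show ?thesis by simp
qed

section \<open>Coding finite sets and course-of-values recursion\<close>

text \<open>Goedel's moduli: they are pairwise coprime once \<open>b\<close> is a multiple of every
  positive difference of the indices in use.\<close>

definition modulus :: "'a \<Rightarrow> 'a \<Rightarrow> 'a" where "modulus b i = \<one> \<oplus> (i \<oplus> \<one>) \<otimes> b"

text \<open>Membership of \<open>i\<close> in the set with code \<open>a\<close>, \<open>b\<close>.
  Plain divisibility needs only products of moduli and no Chinese remainder theorem.\<close>

definition dec :: "'a \<Rightarrow> 'a \<Rightarrow> 'a \<Rightarrow> bool" where "dec a b i \<longleftrightarrow> (\<exists>k. a = k \<otimes> modulus b i)"

text \<open>Multiples of \<open>c\<close> occur on both sides because there is no subtraction.\<close>

definition invertible_mod :: "'a \<Rightarrow> 'a \<Rightarrow> bool" where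
  "invertible_mod a c \<longleftrightarrow> (\<exists>u v w. u \<otimes> a \<oplus> v \<otimes> c = w \<otimes> c \<oplus> \<one>)"

lemma TD_modulus: "TD f \<Longrightarrow> TD g \<Longrightarrow> TD (\<lambda>e. modulus (f e) (g e))"
  unfolding modulus_def by (intro AD_rules)

lemma AD_dec: "TD f \<Longrightarrow> TD g \<Longrightarrow> TD h \<Longrightarrow> AD (\<lambda>e. dec (f e) (g e) (h e))"
  by (rule AD_app3[of dec]) (unfold dec_def, intro AD_rules TD_modulus)

lemma AD_invertible_mod: "TD f \<Longrightarrow> TD g \<Longrightarrow> AD (\<lambda>e. invertible_mod (f e) (g e))"
  by (rule AD_app2[of invertible_mod]) (unfold invertible_mod_def, intro AD_rules)

lemma invertible_mod_one: "invertible_mod \<one> c"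
  unfolding invertible_mod_def by (intro exI[of _ \<one>] exI[of _ \<zero>]) simp

lemma invertible_mod_mul:
  assumes "invertible_mod a c" "invertible_mod a' c" shows "invertible_mod (a \<otimes> a') c"
proof -
  obtain u v w u' v' w' where
    "u \<otimes> a \<oplus> v \<otimes> c = w \<otimes> c \<oplus> \<one>" "u' \<otimes> a' \<oplus> v' \<otimes> c = w' \<otimes> c \<oplus> \<one>"
    using assms unfolding invertible_mod_def by blast
  then have "(u \<otimes> a \<oplus> v \<otimes> c) \<otimes> (u' \<otimes> a' \<oplus> v' \<otimes> c) = (w \<otimes> c \<oplus> \<one>) \<otimes> (w' \<otimes> c \<oplus> \<one>)" by simp
  then have "(u \<otimes> u') \<otimes> (a \<otimes> a') \<oplus> (u \<otimes> a \<otimes> v' \<oplus> v \<otimes> u' \<otimes> a' \<oplus> v \<otimes> v' \<otimes> c) \<otimes> c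
      = (w \<otimes> w' \<otimes> c \<oplus> w \<oplus> w') \<otimes> c \<oplus> \<one>"
    by (simp add: semiring_simps)
  then show ?thesis unfolding invertible_mod_def by blast
qed

text \<open>Two multiples of \<open>c\<close> that differ by 1 make \<open>c\<close> a divisor of 1.
  Comparing \<open>x\<close> with \<open>w\<close> replaces subtraction.\<close>

lemma invertible_mod_self: assumes "invertible_mod (k \<otimes> c) c" shows "c = \<one>"
proof -
  obtain u v w where "u \<otimes> (k \<otimes> c) \<oplus> v \<otimes> c = w \<otimes> c \<oplus> \<one>"
    using assms unfolding invertible_mod_def by blast
  define x where "x = u \<otimes> k \<oplus> v"
  have eq: "x \<otimes> c = w \<otimes> c \<oplus> \<one>"
    using \<open>u \<otimes> (k \<otimes> c) \<oplus> v \<otimes> c = w \<otimes> c \<oplus> \<one>\<close> by (simp add: x_def distrib_right mul_assoc)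
  show ?thesis
  proof (cases "x \<preceq> w")
    case True
    then obtain d where w: "w = x \<oplus> d" unfolding le_iff by blast
    have "x \<otimes> c \<oplus> (d \<otimes> c \<oplus> \<one>) = x \<otimes> c"
      using eq unfolding w distrib_right add_assoc by (rule sym)
    then show ?thesis by (simp only: add_eq_self succ_neq_zero)
  next
    case False
    then obtain d where x: "x = w \<oplus> (d \<oplus> \<one>)" by (auto simp: O.not_le less_iff add_assoc)
    have "w \<otimes> c \<oplus> (d \<otimes> c \<oplus> c) = w \<otimes> c \<oplus> \<one>"
      using eq unfolding x distrib_right one_mul .
    then have *: "d \<otimes> c \<oplus> c = \<zero> \<oplus> \<one>" by (simp add: add_left_cancel)
    then have "c \<noteq> \<zero>" by auto
    then obtain c' where c': "c = c' \<oplus> \<one>" using zero_or_succ by blast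
    have "(d \<otimes> c \<oplus> c') \<oplus> \<one> = \<zero> \<oplus> \<one>" using * by (simp only: add_assoc flip: c')
    then have "d \<otimes> c \<oplus> c' = \<zero>" by (rule succ_inj)
    then show ?thesis using c' by (simp add: add_eq_zero)
  qed
qed

lemma modulus_invertible:
  assumes j: "j = i \<oplus> d" and b: "b = k \<otimes> d"
  shows "invertible_mod (modulus b i) (modulus b j)" "invertible_mod (modulus b j) (modulus b i)"
proof -
  define P where "P = i \<oplus> \<one>"
  have Pj: "j \<oplus> \<one> = P \<oplus> d" by (simp add: P_def j semiring_simps)
  have mi: "modulus b i = \<one> \<oplus> P \<otimes> b" and mj: "modulus b j = \<one> \<oplus> (P \<oplus> d) \<otimes> b"
    unfolding modulus_def Pj by (simp_all add: P_def)
  \<comment> \<open>Write \<open>m_i\<close>, \<open>m_j\<close> for the moduli. Eliminating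
    \<open>b\<close> gives \<open>(P + d) m_i = P m_j + d\<close>. Multiplying by
    \<open>(P + d) k\<close> and using \<open>k d = b\<close> yields the second identity.
    Multiplying by \<open>P k\<close> yields \<open>m_i + P P k m_j = ?\<alpha> m_i + 1\<close>;
    adding \<open>?\<alpha> (P + d) b m_i\<close> turns the right side into a multiple of
    \<open>m_j\<close> plus 1.\<close>
  let ?\<alpha> = "P \<otimes> (P \<oplus> d) \<otimes> k"
  have "(\<one> \<oplus> ?\<alpha> \<otimes> ((P \<oplus> d) \<otimes> b)) \<otimes> modulus b i \<oplus> (P \<otimes> P \<otimes> k) \<otimes> modulus b j
      = (modulus b i \<otimes> ?\<alpha>) \<otimes> modulus b j \<oplus> \<one>"
    unfolding mi mj by (simp add: b semiring_simps)
  then show "invertible_mod (modulus b i) (modulus b j)" unfolding invertible_mod_def by blast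
  have "(\<one> \<oplus> ?\<alpha>) \<otimes> modulus b j \<oplus> \<zero> \<otimes> modulus b i = ((P \<oplus> d) \<otimes> (P \<oplus> d) \<otimes> k) \<otimes> modulus b i \<oplus> \<one>"
    unfolding mi mj by (simp add: b semiring_simps)
  then show "invertible_mod (modulus b j) (modulus b i)" unfolding invertible_mod_def by blast
qed

text \<open>Plays the role of a factorial; \<open>b \<noteq> \<zero>\<close> keeps the moduli
  different from 1.\<close>

lemma common_multiple: "\<exists>b. b \<noteq> \<zero> \<and> (\<forall>d. d \<prec> n \<longrightarrow> (\<exists>k. b = k \<otimes> (d \<oplus> \<one>)))"
proof (induction n rule: M_induct)
  case arith
  show ?case by (intro AD_rules)
next
  case zero
  show ?case by (intro exI[of _ \<one>]) simp
next
  case (suc n)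
  then obtain b where b: "b \<noteq> \<zero>" "\<And>d. d \<prec> n \<Longrightarrow> \<exists>k. b = k \<otimes> (d \<oplus> \<one>)" by blast
  have "b \<otimes> (n \<oplus> \<one>) \<noteq> \<zero>" using b(1) by (simp add: mul_succ add_eq_zero)
  moreover have "\<exists>k. b \<otimes> (n \<oplus> \<one>) = k \<otimes> (d \<oplus> \<one>)" if "d \<prec> n \<oplus> \<one>" for d
  proof (cases "d \<prec> n")
    case True
    then obtain k where "b = k \<otimes> (d \<oplus> \<one>)" using b by blast
    then have "b \<otimes> (n \<oplus> \<one>) = (k \<otimes> (n \<oplus> \<one>)) \<otimes> (d \<oplus> \<one>)" by (simp add: mul_assoc mul_commute mul_left_commute)
    then show ?thesis by blast
  next
    case False
    with that have "d = n" by (simp add: less_succ_iff)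
    then show ?thesis by blast
  qed
  ultimately show ?case by blast
qed

text \<open>\<open>a\<close> is the product of the moduli of the elements of \<open>X\<close> below
  \<open>n\<close>, multiplied in one at a time. Coprimality to the other moduli survives products,
  and at the end it excludes divisibility.\<close>

lemma code_exists:
  assumes X: "X \<in> S" shows "\<exists>a b. \<forall>i. i \<prec> n \<longrightarrow> (dec a b i \<longleftrightarrow> i \<in> X)"
proof -
  obtain b where b: "b \<noteq> \<zero>" "\<And>d. d \<prec> n \<Longrightarrow> \<exists>k. b = k \<otimes> (d \<oplus> \<one>)"
    using common_multiple by blast
  have inv: "invertible_mod (modulus b i) (modulus b j)" if "i \<prec> n" "j \<prec> n" "i \<noteq> j" for i j
  proof -
    have *: "\<exists>d k. j = i \<oplus> d \<and> b = k \<otimes> d" if ij: "i \<prec> j" "j \<prec> n" for i j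
    proof -
      from \<open>i \<prec> j\<close> obtain d where j: "j = i \<oplus> (d \<oplus> \<one>)" by (auto simp: less_iff add_assoc)
      have "d \<prec> j" unfolding j less_iff by (metis add_assoc add_commute)
      then have "d \<prec> n" using ij O.less_trans by blast
      then show ?thesis using b(2) j by blast
    qed
    show ?thesis
    proof (cases "i \<prec> j")
      case True
      with *[OF this] that obtain d k where "j = i \<oplus> d" "b = k \<otimes> d" by blast
      then show ?thesis using modulus_invertible(1) by blast
    next
      case False
      with that have "j \<prec> i" using O.less_linear by blast
      with *[OF this] that obtain d k where "i = j \<oplus> d" "b = k \<otimes> d" by blast
      then show ?thesis using modulus_invertible(2) by blast
    qed
  qed
  have "\<exists>a. \<forall>i. i \<prec> n \<longrightarrow> (i \<in> X \<and> i \<prec> m \<longrightarrow> dec a b i)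
      \<and> (\<not> (i \<in> X \<and> i \<prec> m) \<longrightarrow> invertible_mod a (modulus b i))" for m
  proof (induction m rule: M_induct)
    case arith
    show ?case by (intro AD_rules AD_dec AD_invertible_mod TD_modulus X)
  next
    case zero
    show ?case by (intro exI[of _ \<one>]) (simp add: invertible_mod_one)
  next
    case (suc m)
    then obtain a where a: "\<And>i. i \<prec> n \<Longrightarrow> i \<in> X \<Longrightarrow> i \<prec> m \<Longrightarrow> dec a b i"
      "\<And>i. i \<prec> n \<Longrightarrow> \<not> (i \<in> X \<and> i \<prec> m) \<Longrightarrow> invertible_mod a (modulus b i)" by blast
    show ?case
    proof (cases "m \<in> X \<and> m \<prec> n")
      case False
      then show ?thesis using a by (intro exI[of _ a]) (auto simp: less_succ_iff)
    next
      case True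
      have "dec (a \<otimes> modulus b m) b i" if "i \<prec> n" "i \<in> X" "i \<prec> m \<oplus> \<one>" for i
      proof (cases "i = m")
        case True
        then show ?thesis unfolding dec_def by blast
      next
        case False
        with that have "dec a b i" using a(1) by (auto simp: less_succ_iff)
        then obtain k where "a = k \<otimes> modulus b i" unfolding dec_def by blast
        then have "a \<otimes> modulus b m = (k \<otimes> modulus b m) \<otimes> modulus b i"
          by (simp add: mul_assoc mul_commute mul_left_commute)
        then show ?thesis unfolding dec_def by blast
      qed
      moreover have "invertible_mod (a \<otimes> modulus b m) (modulus b i)"
        if "i \<prec> n" "\<not> (i \<in> X \<and> i \<prec> m \<oplus> \<one>)" for i
        using that True by (intro invertible_mod_mul a inv) (auto simp: less_succ_iff)
      ultimately show ?thesis by blast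
    qed
  qed
  from this[of n] obtain a where a: "\<And>i. i \<prec> n \<Longrightarrow> i \<in> X \<Longrightarrow> dec a b i"
    "\<And>i. i \<prec> n \<Longrightarrow> i \<notin> X \<Longrightarrow> invertible_mod a (modulus b i)" by blast
  have "\<not> dec a b i" if "invertible_mod a (modulus b i)" for i
  proof
    assume "dec a b i"
    then have "modulus b i = \<one>" using that invertible_mod_self unfolding dec_def by blast
    then have "(i \<oplus> \<one>) \<otimes> b = \<zero>" by (simp add: modulus_def add_eq_self)
    then show False using b(1) by (simp add: succ_mul add_eq_zero)
  qed
  with a show ?thesis by blast
qed

text \<open>\<open>\<Phi>\<close> receives the history of \<open>H\<close> below \<open>x\<close> as
  a code, and \<open>ext\<close> makes its verdict independent of the choice of code. Number
  quantifiers over codes keep \<open>H\<close> arithmetical.\<close>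

lemma course_of_values_recursion:
  assumes \<Phi>: "AD (\<lambda>e. \<Phi> (e 0) (e 1) (e 2))"
    and ext: "\<And>a b a' b' x. (\<And>y. y \<prec> x \<Longrightarrow> dec a b y \<longleftrightarrow> dec a' b' y) \<Longrightarrow> \<Phi> a b x \<longleftrightarrow> \<Phi> a' b' x"
  shows "\<exists>H\<in>S. \<forall>x a b. (\<forall>y. y \<prec> x \<longrightarrow> (dec a b y \<longleftrightarrow> y \<in> H)) \<longrightarrow> (x \<in> H \<longleftrightarrow> \<Phi> a b x)"
proof -
  note AD_\<Phi> = AD_app3[OF \<Phi>]
  \<comment> \<open>Two such codes agree where both apply, and one exists for each \<open>x\<close>;
    so \<open>H\<close> can read off its value at \<open>x\<close> from any of them.\<close>
  define good where "good x a b \<longleftrightarrow> (\<forall>y. y \<prec> x \<longrightarrow> (dec a b y \<longleftrightarrow> \<Phi> a b y))" for x a b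
  have AD_good: "AD (\<lambda>e. good (f e) (g e) (h e))" if "TD f" "TD g" "TD h" for f g h
    by (rule AD_app3[of good, OF _ that]) (unfold good_def, intro AD_rules AD_dec AD_\<Phi>)
  have uniq: "dec a b y \<longleftrightarrow> dec a' b' y" if "good x a b" "good x' a' b'" "y \<prec> x" "y \<prec> x'" for x x' y a b a' b'
  proof -
    have "y \<prec> x \<longrightarrow> y \<prec> x' \<longrightarrow> (dec a b y \<longleftrightarrow> dec a' b' y)" for y
    proof (induction y rule: M_less_induct)
      case arith
      show ?case by (intro AD_rules AD_dec)
    next
      case (less y)
      show ?case
      proof (intro impI)
        assume y: "y \<prec> x" "y \<prec> x'"
        have "\<Phi> a b y \<longleftrightarrow> \<Phi> a' b' y"
          by (rule ext) (use less y O.less_trans in blast)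
        with y that show "dec a b y \<longleftrightarrow> dec a' b' y" by (simp add: good_def)
      qed
    qed
    with that show ?thesis by blast
  qed
  have ex: "\<exists>a b. good x a b" for x
  proof (induction x rule: M_induct)
    case arith
    show ?case by (intro AD_rules AD_good)
  next
    case zero
    show ?case by (simp add: good_def)
  next
    case (suc x)
    then obtain a b where ab: "good x a b" by blast
    \<comment> \<open>The old code is cut off at \<open>x\<close> before the new value is added,
      since from \<open>x\<close> on it is arbitrary.\<close>
    have "{y. (y \<prec> x \<and> dec a b y) \<or> (y = x \<and> \<Phi> a b x)} \<in> S"
      by (rule comprehension) (intro AD_rules AD_dec)
    from code_exists[OF this, of "x \<oplus> \<one>"] obtain a' b' where
      *: "\<And>y. y \<prec> x \<oplus> \<one> \<Longrightarrow> dec a' b' y \<longleftrightarrow> (y \<prec> x \<and> dec a b y) \<or> (y = x \<and> \<Phi> a b x)" by auto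
    have **: "\<Phi> a' b' y \<longleftrightarrow> \<Phi> a b y" if "y \<prec> x \<oplus> \<one>" for y
    proof (rule ext)
      fix z assume "z \<prec> y"
      then have "z \<prec> x" using that O.less_trans by (auto simp: less_succ_iff)
      then show "dec a' b' z \<longleftrightarrow> dec a b z" using *[of z] by (auto simp: less_succ_iff)
    qed
    have "good (x \<oplus> \<one>) a' b'"
      unfolding good_def using * ** ab[unfolded good_def] by (auto simp: less_succ_iff)
    then show ?case by blast
  qed
  define H where "H = {x. \<exists>a b. good x a b \<and> \<Phi> a b x}"
  have "H \<in> S" unfolding H_def by (rule comprehension) (intro AD_rules AD_good AD_\<Phi>)
  have H_good: "y \<in> H \<longleftrightarrow> dec a b y" if "good x a b" "y \<prec> x" for x a b y
  proof -
    have g: "good y a b" using that O.less_trans unfolding good_def by blast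
    have "\<Phi> a' b' y \<longleftrightarrow> \<Phi> a b y" if "good y a' b'" for a' b'
      by (rule ext) (use uniq g that in blast)
    then have "y \<in> H \<longleftrightarrow> \<Phi> a b y" using g unfolding H_def by blast
    with that show ?thesis by (simp add: good_def)
  qed
  have "x \<in> H \<longleftrightarrow> \<Phi> a b x" if *: "\<forall>y. y \<prec> x \<longrightarrow> (dec a b y \<longleftrightarrow> y \<in> H)" for x a b
  proof -
    have "\<Phi> a' b' x \<longleftrightarrow> \<Phi> a b x" if "good x a' b'" for a' b'
      by (rule ext) (use H_good[OF that] * in blast)
    then show ?thesis unfolding H_def using ex[of x] by blast
  qed
  with \<open>H \<in> S\<close> show ?thesis by blast
qed

section \<open>Sparse sets meeting infinitely many infinite sets\<close>

text \<open>Read \<open>B r\<close> as requirement number \<open>r\<close> and \<open>R\<close> as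
  compatibility with an earlier element. A candidate enters when it is compatible and meets the
  least unmet requirement. If \<open>r\<close> were the least requirement never met,
  \<open>H\<close> would be bounded, so large candidates for \<open>r\<close> would be compatible
  with all of \<open>H\<close> and one would enter.\<close>

lemma sparse_transversal:
  assumes B: "AD (\<lambda>e. B (e 0) (e 1))" and R: "AD (\<lambda>e. R (e 0) (e 1))"
    and B_unbounded: "\<And>r p. \<exists>x. p \<prec> x \<and> B r x"
    and R_eventually: "\<And>h. \<exists>p. \<forall>x. p \<prec> x \<longrightarrow> R h x"
  shows "\<exists>H\<in>S. (\<forall>r. \<exists>x\<in>H. B r x) \<and> (\<forall>x\<in>H. \<exists>r. B r x) \<and> (\<forall>h\<in>H. \<forall>x\<in>H. h \<prec> x \<longrightarrow> R h x)"
proof -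
  text \<open>The greedy choice, with \<open>a, b\<close> coding the elements of \<open>H\<close> below \<open>x\<close>.\<close>
  define \<Phi> where "\<Phi> a b x \<longleftrightarrow> (\<forall>h. h \<prec> x \<and> dec a b h \<longrightarrow> R h x) \<and>
    (\<exists>r. B r x \<and> (\<forall>y. y \<prec> x \<and> dec a b y \<longrightarrow> \<not> B r y)
       \<and> (\<forall>r'. r' \<prec> r \<longrightarrow> (\<exists>y. y \<prec> x \<and> dec a b y \<and> B r' y)))" for a b x
  have "\<exists>H\<in>S. \<forall>x a b. (\<forall>y. y \<prec> x \<longrightarrow> (dec a b y \<longleftrightarrow> y \<in> H)) \<longrightarrow> (x \<in> H \<longleftrightarrow> \<Phi> a b x)"
  proof (rule course_of_values_recursion)
    show "AD (\<lambda>e. \<Phi> (e 0) (e 1) (e 2))"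
      unfolding \<Phi>_def by (intro AD_rules AD_dec AD_app2[OF B] AD_app2[OF R])
  next
    fix a b a' b' x assume "\<And>y. y \<prec> x \<Longrightarrow> dec a b y \<longleftrightarrow> dec a' b' y"
    then show "\<Phi> a b x \<longleftrightarrow> \<Phi> a' b' x" unfolding \<Phi>_def by (simp cong: conj_cong)
  qed
  then obtain H where H: "H \<in> S"
    "\<And>x a b. (\<And>y. y \<prec> x \<Longrightarrow> dec a b y \<longleftrightarrow> y \<in> H) \<Longrightarrow> x \<in> H \<longleftrightarrow> \<Phi> a b x" by blast
  have mem_H: "x \<in> H \<longleftrightarrow> (\<forall>h. h \<prec> x \<and> h \<in> H \<longrightarrow> R h x) \<and>
    (\<exists>r. B r x \<and> (\<forall>y. y \<prec> x \<and> y \<in> H \<longrightarrow> \<not> B r y)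
       \<and> (\<forall>r'. r' \<prec> r \<longrightarrow> (\<exists>y. y \<prec> x \<and> y \<in> H \<and> B r' y)))" for x
  proof -
    obtain a b where ab: "\<And>y. y \<prec> x \<Longrightarrow> dec a b y \<longleftrightarrow> y \<in> H" using code_exists[OF H(1)] by blast
    then have "x \<in> H \<longleftrightarrow> \<Phi> a b x" by (rule H(2))
    then show ?thesis unfolding \<Phi>_def by (simp add: ab cong: conj_cong)
  qed
  have "\<exists>x. x \<in> H \<and> B r x" for r
  proof (induction r rule: M_less_induct)
    case arith
    show ?case by (intro AD_rules AD_app2[OF B] H)
  next
    case (less r)
    show ?case
    proof (rule ccontr)
      assume none: "\<nexists>x. x \<in> H \<and> B r x"
      have "\<exists>p. \<forall>r'. r' \<prec> r \<longrightarrow> (\<exists>y. y \<prec> p \<and> y \<in> H \<and> B r' y)"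
      proof (rule bounding)
        show "AD (\<lambda>e. \<exists>y. y \<prec> e 1 \<and> y \<in> H \<and> B (e 0) y)" by (intro AD_rules AD_app2[OF B] H)
      next
        show "\<exists>p y. y \<prec> p \<and> y \<in> H \<and> B r' y" if "r' \<prec> r" for r'
          using less[OF that] less_succ by blast
      qed (use O.less_le_trans in blast)
      then obtain p where p: "\<And>r'. r' \<prec> r \<Longrightarrow> \<exists>y. y \<prec> p \<and> y \<in> H \<and> B r' y" by blast
      \<comment> \<open>From \<open>p\<close> on all requirements below \<open>r\<close> are met. A
        new element would have to serve \<open>r\<close> itself or a later requirement, and the
        latter is barred while \<open>r\<close> is unmet.\<close>
      have H_below: "x \<prec> p" if x: "x \<in> H" for x
      proof (rule ccontr)
        assume "\<not> x \<prec> p"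
        then have "p \<preceq> x" by simp
        obtain r'' where r'': "B r'' x" "\<forall>y. y \<prec> x \<and> y \<in> H \<longrightarrow> \<not> B r'' y"
          "\<forall>r'. r' \<prec> r'' \<longrightarrow> (\<exists>y. y \<prec> x \<and> y \<in> H \<and> B r' y)"
          using mem_H[THEN iffD1, OF x] by blast
        have "\<not> r'' \<prec> r" using p r''(2) \<open>p \<preceq> x\<close> O.less_le_trans by blast
        moreover have "r'' \<noteq> r" using none x r''(1) by blast
        moreover have "\<not> r \<prec> r''" using none r''(3) by blast
        ultimately show False by auto
      qed
      have "\<exists>q. \<forall>h. h \<prec> p \<longrightarrow> (\<forall>x. q \<prec> x \<longrightarrow> R h x)"
      proof (rule bounding)
        show "AD (\<lambda>e. \<forall>x. e 1 \<prec> x \<longrightarrow> R (e 0) x)" by (intro AD_rules AD_app2[OF R])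
      qed (use O.le_less_trans R_eventually in blast)+
      then obtain q where q: "\<And>h x. h \<prec> p \<Longrightarrow> q \<prec> x \<Longrightarrow> R h x" by blast
      obtain x where x: "p \<oplus> q \<prec> x" "B r x" using B_unbounded by blast
      then have "p \<prec> x" "q \<prec> x" using le_add O.le_less_trans by blast+
      have "\<forall>h. h \<prec> x \<and> h \<in> H \<longrightarrow> R h x" using q[OF H_below \<open>q \<prec> x\<close>] by blast
      moreover have "\<forall>r'. r' \<prec> r \<longrightarrow> (\<exists>y. y \<prec> x \<and> y \<in> H \<and> B r' y)"
        using p \<open>p \<prec> x\<close> O.less_trans by blast
      ultimately have "x \<in> H" using x(2) none by (intro mem_H[THEN iffD2]) blast
      then show False using none x(2) by blast
    qed
  qed
  moreover have "\<exists>r. B r x" if "x \<in> H" for x using that mem_H[of x] by blast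
  moreover have "R h x" if "h \<in> H" "x \<in> H" "h \<prec> x" for h x using that mem_H[of x] by blast
  ultimately show ?thesis using H(1) by blast
qed

text \<open>For \<open>v \<preceq> s\<close> the value lies below \<open>(s + 1)^2\<close>, so
  \<open>s\<close> is its integer square root. One number can thus code a vertex \<open>v\<close>
  together with an arbitrarily large label \<open>s\<close>.\<close>

lemma square_add_unique:
  assumes "s \<otimes> s \<oplus> v = s' \<otimes> s' \<oplus> v'" "v \<preceq> s" "v' \<preceq> s'" shows "s = s' \<and> v = v'"
proof -
  have *: False if eq: "s \<otimes> s \<oplus> v = s' \<otimes> s' \<oplus> v'" and "v \<preceq> s" and "s \<prec> s'" for s v s' v'
  proof -
    obtain c where c: "s = v \<oplus> c" using \<open>v \<preceq> s\<close> le_iff by blast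
    obtain d where "s' = s \<oplus> d \<oplus> \<one>" using \<open>s \<prec> s'\<close> less_iff by blast
    then have "s' \<otimes> s' = s \<otimes> s \<oplus> (s \<oplus> (s \<oplus> s \<otimes> d \<oplus> d \<otimes> s \<oplus> d \<otimes> d \<oplus> d \<oplus> d \<oplus> \<one>))"
      by (simp add: semiring_simps)
    then have "s \<otimes> s \<oplus> v = s \<otimes> s \<oplus> (s \<oplus> (s \<oplus> s \<otimes> d \<oplus> d \<otimes> s \<oplus> d \<otimes> d \<oplus> d \<oplus> d \<oplus> \<one> \<oplus> v'))"
      using eq by (simp add: add_assoc)
    then have "v \<oplus> (c \<oplus> (s \<oplus> s \<otimes> d \<oplus> d \<otimes> s \<oplus> d \<otimes> d \<oplus> d \<oplus> d \<oplus> \<one> \<oplus> v')) = v"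
      unfolding add_left_cancel using c add_assoc by metis
    then show False unfolding add_eq_self add_eq_zero using one_neq_zero by blast
  qed
  have "s = s'" using *[OF assms(1,2)] *[OF assms(1)[symmetric] assms(3)] by (meson O.neqE)
  then show ?thesis using assms(1) add_left_cancel by blast
qed

section \<open>The refined Rival--Sands theorem\<close>

definition unbounded :: "('a \<Rightarrow> bool) \<Rightarrow> bool" where
  "unbounded P \<longleftrightarrow> (\<forall>p. \<exists>x. p \<prec> x \<and> P x)"

text \<open>\<open>W\<close> collects the vertices to be hit infinitely often. If a vertex outside
  \<open>W\<close> had neighbours \<open>h \<prec> x\<close> in \<open>H\<close>, it would by
  symmetry be a neighbour of \<open>h\<close>, and then \<open>R h x\<close> forbids its adjacency
  to \<open>x\<close>.\<close>

lemma rival_sands_unbounded: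
  assumes V: "V \<in> S" and N: "AD (\<lambda>e. N (e 0) (e 1))" and N_V: "\<And>x y. N x y \<Longrightarrow> y \<in> V"
    and sym: "\<And>x y. x \<in> V \<Longrightarrow> N x y \<Longrightarrow> N y x" and irrefl: "\<And>x. \<not> N x x"
    and F: "F = {x. x \<in> V \<and> \<not> unbounded (N x)}" "unbounded (\<lambda>x. x \<in> F)"
  shows "\<exists>H\<in>S. unbounded (\<lambda>x. x \<in> H) \<and> H \<subseteq> V
    \<and> (\<forall>x\<in>V. unbounded (\<lambda>y. y \<in> H \<and> N x y) \<or> (\<forall>y\<in>H. \<forall>z\<in>H. N x y \<longrightarrow> N x z \<longrightarrow> y = z))
    \<and> (\<forall>x\<in>H. \<forall>y\<in>H. \<not> N x y)"
proof -
  note AD_N = AD_app2[OF N]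
  have F_S: "F \<in> S" unfolding F(1) unbounded_def by (rule comprehension) (intro AD_rules AD_N V)
  define W where "W = {v. v \<in> V \<and> unbounded (\<lambda>x. x \<in> F \<and> N v x)}"
  have W_S: "W \<in> S"
    unfolding W_def unbounded_def by (rule comprehension) (intro AD_rules AD_N V F_S)
  text \<open>Every \<open>v\<close> is coded by arbitrarily large \<open>r = s\<^sup>2 + v\<close>, so meeting all \<open>B r\<close> forces
    infinitely many neighbours of each \<open>v \<in> W\<close> into \<open>H\<close>.\<close>
  define B where "B r x \<longleftrightarrow> x \<in> F \<and>
    (\<forall>v s. r = s \<otimes> s \<oplus> v \<and> v \<preceq> s \<longrightarrow> s \<prec> x \<and> (v \<in> W \<longrightarrow> N v x))" for r x
  \<comment> \<open>An \<open>h\<close> outside \<open>F\<close> may have infinitely many neighbours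
    and then has no threshold; the guard makes the condition vacuous for it.\<close>
  define R where "R h x \<longleftrightarrow> (h \<in> F \<and> x \<in> F \<longrightarrow>
    \<not> N h x \<and> (\<forall>v. N h v \<and> v \<notin> W \<longrightarrow> \<not> N v x))" for h x
  have "\<exists>H\<in>S. (\<forall>r. \<exists>x\<in>H. B r x) \<and> (\<forall>x\<in>H. \<exists>r. B r x) \<and> (\<forall>h\<in>H. \<forall>x\<in>H. h \<prec> x \<longrightarrow> R h x)"
  proof (rule sparse_transversal)
    show "AD (\<lambda>e. B (e 0) (e 1))" unfolding B_def by (intro AD_rules AD_le AD_N F_S W_S)
    show "AD (\<lambda>e. R (e 0) (e 1))" unfolding R_def by (intro AD_rules AD_N F_S W_S)
  next
    fix r p
    show "\<exists>x. p \<prec> x \<and> B r x"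
    proof (cases "\<exists>v s. r = s \<otimes> s \<oplus> v \<and> v \<preceq> s")
      case False
      then show ?thesis using F(2) unfolding B_def unbounded_def by blast
    next
      case True
      then obtain v s where r: "r = s \<otimes> s \<oplus> v" "v \<preceq> s" by blast
      have "unbounded (\<lambda>x. x \<in> F \<and> (v \<in> W \<longrightarrow> N v x))"
        using F(2) by (cases "v \<in> W") (auto simp: W_def)
      then obtain x where x: "p \<oplus> s \<prec> x" "x \<in> F" "v \<in> W \<longrightarrow> N v x" unfolding unbounded_def by blast
      have "s' = s \<and> v' = v" if "r = s' \<otimes> s' \<oplus> v'" "v' \<preceq> s'" for s' v'
        using square_add_unique[of s v s' v'] that r by simp
      moreover have "p \<prec> x" "s \<prec> x" using x(1) le_add O.le_less_trans by blast+
      ultimately show ?thesis unfolding B_def using x by blast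
    qed
  next
    fix h
    show "\<exists>p. \<forall>x. p \<prec> x \<longrightarrow> R h x"
    proof (cases "h \<in> F")
      case False
      then show ?thesis by (simp add: R_def)
    next
      case True
      then obtain p where p: "\<And>y. N h y \<Longrightarrow> y \<preceq> p" unfolding F(1) unbounded_def by (auto simp flip: O.not_less)
      \<comment> \<open>All neighbours of \<open>h\<close> are at most \<open>p\<close>, and
        \<open>p \<oplus> \<one>\<close> makes the strict bound include \<open>p\<close>. Each
        neighbour outside \<open>W\<close> has its own threshold; \<open>q\<close> serves for all of
        them.\<close>
      have "\<exists>q. \<forall>v. v \<prec> p \<oplus> \<one> \<longrightarrow> (\<forall>x. q \<prec> x \<longrightarrow> N h v \<and> v \<notin> W \<and> x \<in> F \<longrightarrow> \<not> N v x)"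
      proof (rule bounding)
        show "AD (\<lambda>e. \<forall>x. e 1 \<prec> x \<longrightarrow> N h (e 0) \<and> e 0 \<notin> W \<and> x \<in> F \<longrightarrow> \<not> N (e 0) x)"
          by (intro AD_rules AD_N F_S W_S)
      next
        show "\<exists>q. \<forall>x. q \<prec> x \<longrightarrow> N h v \<and> v \<notin> W \<and> x \<in> F \<longrightarrow> \<not> N v x" for v
          using N_V[of h v] unfolding W_def unbounded_def by blast
      qed (use O.le_less_trans in blast)
      then obtain q where q: "\<And>v x. v \<preceq> p \<Longrightarrow> q \<prec> x \<Longrightarrow> N h v \<Longrightarrow> v \<notin> W \<Longrightarrow> x \<in> F \<Longrightarrow> \<not> N v x"
        unfolding less_succ_iff le_def by blast
      have "R h x" if x: "p \<oplus> q \<prec> x" for x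
      proof -
        have "p \<prec> x" "q \<prec> x" using x le_add O.le_less_trans by blast+
        then show ?thesis unfolding R_def using p q O.not_le by blast
      qed
      then show ?thesis by blast
    qed
  qed
  then obtain H where H: "H \<in> S" "\<And>r. \<exists>x\<in>H. B r x" "\<And>x. x \<in> H \<Longrightarrow> \<exists>r. B r x"
    "\<And>h x. h \<in> H \<Longrightarrow> x \<in> H \<Longrightarrow> h \<prec> x \<Longrightarrow> R h x" by blast
  have HF: "H \<subseteq> F" using H(3) by (auto simp: B_def)
  have FV: "F \<subseteq> V" using F(1) by auto
  have meet: "\<exists>x. p \<prec> x \<and> x \<in> H \<and> (v \<in> W \<longrightarrow> N v x)" for p v
  proof -
    \<comment> \<open>The label \<open>p \<oplus> v\<close> is at least \<open>v\<close>, as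
      decoding demands, and pushes \<open>x\<close> above \<open>p\<close>.\<close>
    obtain x where "x \<in> H" "B ((p \<oplus> v) \<otimes> (p \<oplus> v) \<oplus> v) x" using H(2) by blast
    then have "p \<oplus> v \<prec> x" "v \<in> W \<longrightarrow> N v x"
      unfolding B_def using le_add(2)[of v p] by blast+
    then show ?thesis using \<open>x \<in> H\<close> le_add O.le_less_trans by blast
  qed
  have le: "z \<preceq> y" if "x \<in> V" "x \<notin> W" "y \<in> H" "z \<in> H" "N x y" "N x z" for x y z
  proof (rule ccontr)
    assume "\<not> z \<preceq> y"
    then have "R y z" using H(4) that by (simp add: O.not_le)
    then show False using that HF sym[of x y] unfolding R_def by blast
  qed
  have "\<not> N x y" if xy: "x \<in> H" "y \<in> H" for x y
  proof -
    have *: "\<not> N x y" if "x \<in> H" "y \<in> H" "x \<prec> y" for x y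
      using H(4)[OF that] that HF unfolding R_def by blast
    show ?thesis
      using *[of x y] *[of y x] xy sym[of x y] irrefl[of x] HF FV O.less_linear[of x y] by blast
  qed
  moreover have "unbounded (\<lambda>y. y \<in> H \<and> N x y) \<or> (\<forall>y\<in>H. \<forall>z\<in>H. N x y \<longrightarrow> N x z \<longrightarrow> y = z)"
    if "x \<in> V" for x
  proof (cases "x \<in> W")
    case True
    then show ?thesis using meet[of _ x] unfolding unbounded_def by blast
  next
    case False
    then show ?thesis using le[OF that] O.order.antisym by blast
  qed
  moreover have "unbounded (\<lambda>x. x \<in> H)" using meet unfolding unbounded_def by blast
  ultimately show ?thesis using H(1) HF FV by blast
qed

text \<open>Cutting off an initial segment cannot destroy an unbounded neighbourhood, while the
  neighbours of all vertices in \<open>F\<close> lie at or below one \<open>q\<close>. A vertex of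
  \<open>F\<close> beyond \<open>q\<close> may stay in \<open>H\<close>: it has no neighbour
  there.\<close>

lemma rival_sands_bounded:
  assumes V: "V \<in> S" "unbounded (\<lambda>x. x \<in> V)" and N: "AD (\<lambda>e. N (e 0) (e 1))"
    and N_V: "\<And>x y. N x y \<Longrightarrow> y \<in> V"
    and F: "F = {x. x \<in> V \<and> \<not> unbounded (N x)}" "\<not> unbounded (\<lambda>x. x \<in> F)"
  shows "\<exists>H\<in>S. unbounded (\<lambda>x. x \<in> H) \<and> H \<subseteq> V
    \<and> (\<forall>x\<in>V. unbounded (\<lambda>y. y \<in> H \<and> N x y) \<or> (\<forall>y\<in>H. \<not> N x y))"
proof -
  note AD_N = AD_app2[OF N]
  have F_S: "F \<in> S" unfolding F(1) unbounded_def by (rule comprehension) (intro AD_rules AD_N V)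
  obtain p where p: "\<And>x. x \<in> F \<Longrightarrow> x \<preceq> p"
    using F(2) unfolding unbounded_def by (auto simp flip: O.not_less)
  have "\<exists>q. \<forall>x. x \<prec> p \<oplus> \<one> \<longrightarrow> (\<forall>y. q \<prec> y \<longrightarrow> x \<in> F \<longrightarrow> \<not> N x y)"
  proof (rule bounding)
    show "AD (\<lambda>e. \<forall>y. e 1 \<prec> y \<longrightarrow> e 0 \<in> F \<longrightarrow> \<not> N (e 0) y)" by (intro AD_rules AD_N F_S)
  next
    show "\<exists>q. \<forall>y. q \<prec> y \<longrightarrow> x \<in> F \<longrightarrow> \<not> N x y" for x
      unfolding F(1) unbounded_def by blast
  qed (use O.le_less_trans in blast)
  then obtain q where q: "\<And>x y. x \<in> F \<Longrightarrow> q \<prec> y \<Longrightarrow> \<not> N x y"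
    using p unfolding less_succ_iff le_def by blast
  define H where "H = {x. x \<in> V \<and> q \<prec> x}"
  have "H \<in> S" unfolding H_def by (rule comprehension) (intro AD_rules V)
  have beyond: "unbounded (\<lambda>x. q \<prec> x \<and> P x)" if P: "unbounded P" for P
    unfolding unbounded_def
  proof
    fix r
    obtain x where "r \<oplus> q \<prec> x" "P x" using P unfolding unbounded_def by blast
    then show "\<exists>x. r \<prec> x \<and> q \<prec> x \<and> P x" using le_add O.le_less_trans by blast
  qed
  have "unbounded (\<lambda>x. x \<in> H)" using beyond[OF V(2)] by (simp add: H_def conj_commute)
  moreover have "unbounded (\<lambda>y. y \<in> H \<and> N x y) \<or> (\<forall>y\<in>H. \<not> N x y)" if "x \<in> V" for x
  proof (cases "x \<in> F")
    case True
    then show ?thesis using q by (auto simp: H_def)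
  next
    case False
    then have "unbounded (\<lambda>y. q \<prec> y \<and> N x y)" using that F(1) by (intro beyond) auto
    moreover have "(q \<prec> y \<and> N x y) = (y \<in> H \<and> N x y)" for y using N_V by (auto simp: H_def)
    ultimately show ?thesis by simp
  qed
  moreover have "H \<subseteq> V" by (auto simp: H_def)
  ultimately show ?thesis using \<open>H \<in> S\<close> by blast
qed

lemma rival_sands:
  assumes V: "V \<in> S" "unbounded (\<lambda>x. x \<in> V)" and N: "AD (\<lambda>e. N (e 0) (e 1))"
    and N_V: "\<And>x y. N x y \<Longrightarrow> y \<in> V"
    and sym: "\<And>x y. x \<in> V \<Longrightarrow> N x y \<Longrightarrow> N y x" and irrefl: "\<And>x. \<not> N x x"
  shows "\<exists>H\<in>S. unbounded (\<lambda>x. x \<in> H) \<and> H \<subseteq> V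
    \<and> (\<forall>x\<in>V. unbounded (\<lambda>y. y \<in> H \<and> N x y) \<or> (\<forall>y\<in>H. \<forall>z\<in>H. N x y \<longrightarrow> N x z \<longrightarrow> y = z))
    \<and> (\<forall>x\<in>H. unbounded (\<lambda>y. y \<in> H \<and> N x y) \<or> (\<forall>y\<in>H. \<not> N x y))"
proof (cases "unbounded (\<lambda>x. x \<in> {x. x \<in> V \<and> \<not> unbounded (N x)})")
  case True
  have "\<exists>H\<in>S. unbounded (\<lambda>x. x \<in> H) \<and> H \<subseteq> V
    \<and> (\<forall>x\<in>V. unbounded (\<lambda>y. y \<in> H \<and> N x y) \<or> (\<forall>y\<in>H. \<forall>z\<in>H. N x y \<longrightarrow> N x z \<longrightarrow> y = z))
    \<and> (\<forall>x\<in>H. \<forall>y\<in>H. \<not> N x y)"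
    using V(1) N N_V sym irrefl refl True by (rule rival_sands_unbounded)
  then show ?thesis by blast
next
  case False
  have "\<exists>H\<in>S. unbounded (\<lambda>x. x \<in> H) \<and> H \<subseteq> V
    \<and> (\<forall>x\<in>V. unbounded (\<lambda>y. y \<in> H \<and> N x y) \<or> (\<forall>y\<in>H. \<not> N x y))"
    using V N N_V refl False by (rule rival_sands_bounded)
  then obtain H where H: "H \<in> S" "unbounded (\<lambda>x. x \<in> H)" "H \<subseteq> V"
    "\<forall>x\<in>V. unbounded (\<lambda>y. y \<in> H \<and> N x y) \<or> (\<forall>y\<in>H. \<not> N x y)" by blast
  show ?thesis using H by (intro bexI[of _ H]) blast+
qed

section \<open>Evaluation of the formal sentence in a model\<close>

lemma sat_refined_rival_sands: "sat e s refined_rival_sands"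
proof -
  define pr where "pr x y = (x \<oplus> y) \<otimes> (x \<oplus> y) \<oplus> x" for x y
  \<comment> \<open>Consulting both orders of the endpoints gives symmetry, restricted to
    \<open>x \<in> V\<close> because only the second argument is checked for membership; strictness
    of \<open>\<prec>\<close> gives irreflexivity.\<close>
  define N where "N V E x y \<longleftrightarrow> y \<in> V \<and> (x \<prec> y \<and> pr x y \<in> E \<or> y \<prec> x \<and> pr y x \<in> E)" for V E x y
  have nbr: "sat e s (nbr V E t u) \<longleftrightarrow> N (s V) (s E) (ev e t) (ev e u)" for e s V E t u
    by (auto simp: nbr_def edge_def pair_def N_def pr_def)
  have sat_H: "\<exists>H\<in>S. sat e (case_nat H (case_nat E (case_nat V s))) (rival_sands_solution 2 1 0)"
    if VE: "V \<in> S" "E \<in> S" and unb: "unbounded (\<lambda>x. x \<in> V)" for V E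
  proof -
    have "AD (\<lambda>e. N V E (e 0) (e 1))" unfolding N_def pr_def by (intro AD_rules VE)
    moreover have "y \<in> V" if "N V E x y" for x y using that by (simp add: N_def)
    moreover have "N V E y x" if "x \<in> V" "N V E x y" for x y using that by (auto simp: N_def)
    moreover have "\<not> N V E x x" for x by (simp add: N_def)
    ultimately obtain H where H: "H \<in> S"
      "unbounded (\<lambda>x. x \<in> H)" "H \<subseteq> V"
      "\<forall>x\<in>V. unbounded (\<lambda>y. y \<in> H \<and> N V E x y) \<or> (\<forall>y\<in>H. \<forall>z\<in>H. N V E x y \<longrightarrow> N V E x z \<longrightarrow> y = z)"
      "\<forall>x\<in>H. unbounded (\<lambda>y. y \<in> H \<and> N V E x y) \<or> (\<forall>y\<in>H. \<not> N V E x y)"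
      using rival_sands[of V "N V E", OF VE(1) unb] by blast
    have "sat e (case_nat H (case_nat E (case_nat V s))) (rival_sands_solution 2 1 0)"
      using H(2-5)
      by (simp add: rival_sands_solution_def infinite_set_def infinite_inter_nbr_def
          at_most_one_inter_nbr_def empty_inter_nbr_def mem_inter_nbr_def nbr unbounded_def
          numeral_2_eq_2 lift_tm_def) blast
    with H(1) show ?thesis by blast
  qed
  show ?thesis
    using sat_H by (simp add: refined_rival_sands_def infinite_set_def unbounded_def)
qed

end

lemma sentence_refined_rival_sands: "sentence refined_rival_sands"
  by (simp add: sentence_def refined_rival_sands_def rival_sands_solution_def is_graph_def
      infinite_set_def infinite_inter_nbr_def at_most_one_inter_nbr_def empty_inter_nbr_def
      mem_inter_nbr_def nbr_def edge_def pair_def lift_tm_def)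

theorem theorem3p2: "ACA0 \<turnstile> refined_rival_sands"
  by (rule ACA0_complete)
    (rule ACA0_model.sat_refined_rival_sands sentence_refined_rival_sands, assumption?)+

end
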